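(* Let $G=(V,E)$ be a finite, connected, non-bipartite, symmetric directed graph and $m\ge1$. Consider Frontier Sampling (FS) on $G$ with $m$ walkers: the state is $L=(v_1,\dots,v_m)\in V^m$; at each step an index $i$ is chosen with probability $\deg(v_i)/\sum_{j=1}^m\deg(v_j)$, an outgoing edge $(v_i,w)$ of $v_i$ is chosen uniformly at random, $v_i$ is replaced by $w$, and $(v_i,w)$ is appended to the sequence of sampled edges. Then, in steady state, FS has the following properties: (I) the sampled edges are sampled uniformly at random from $E$ and form a stationary sequence; (II) the stationary distribution of the state $L_\infty=(v_1,\dots,v_m)$ is unique and equal to \[ P[L_\infty=(v_1,\dots,v_m)]=\frac{\sum_{i=1}^m\deg(v_i)}{m\,|V|^{m-1}\,\mathrm{vol}(V)}; \] (III) the sequence of sampled edges satisfies the strong law of large numbers: for any non-empty $E^\star\subseteq E$ and any $f:E^\star\to\mathbb{R}$ with $\sum_{(u,v)\in E^\star}|f(u,v)|<\infty$, if $B^\star(B)$ denotes the number of the first $B$ sampled edges lying in $E^\star$ and $(u_i,v_i)$ the $i$-th sampled edge lying in $E^\star$, then $\frac{1}{B^\star(B)}\sum_{i=1}^{B^\star(B)}f(u_i,v_i)\to\frac{1}{|E^\star|}\sum_{(u,v)\in E^\star}f(u,v)$ almost surely as $B\to\infty$.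
   Context: A graph $G$ is symmetric directed if $(u,v)\in E$ implies $(v,u)\in E$; $\deg(v)$ is the (common) in- and out-degree of $v$; $\mathrm{vol}(S)=\sum_{v\in S}\deg(v)$. *)

theory Defs
  imports "HOL-Probability.Probability" "Graph_Theory.Graph_Theory"
begin

text \<open>
  Finite symmetric directed graphs are rendered by the locale \<open>pair_pseudo_graph\<close>: the arcs are
  ordered pairs of vertices, the arc relation is finite and symmetric, and loops are not excluded.
\<close>

definition bipartite :: "'a pair_pre_digraph \<Rightarrow> bool" where
  "bipartite G \<longleftrightarrow> (\<exists>A B. A \<union> B = pverts G \<and> A \<inter> B = {} \<and>
     (\<forall>(u, v) \<in> parcs G. u \<in> A \<and> v \<in> B \<or> u \<in> B \<and> v \<in> A))"

definition deg :: "'a pair_pre_digraph \<Rightarrow> 'a \<Rightarrow> nat" where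
  "deg G v = out_degree (with_proj G) v"

lemma (in pair_sym_digraph) deg_eq_in_degree: "deg G v = in_degree (with_proj G) v"
proof -
  have "bij_betw prod.swap (out_arcs (with_proj G) v) (in_arcs (with_proj G) v)"
    by (rule bij_betw_byWitness[where f' = prod.swap])
       (auto simp: out_arcs_def in_arcs_def dest: arcs_symmetric)
  then show ?thesis
    unfolding deg_def out_degree_def in_degree_def by (rule bij_betw_same_card)
qed

definition vol :: "'a pair_pre_digraph \<Rightarrow> 'a set \<Rightarrow> nat" where
  "vol G S = (\<Sum>v\<in>S. deg G v)"

definition fs_states :: "'a pair_pre_digraph \<Rightarrow> nat \<Rightarrow> 'a list set" where
  "fs_states G m = {l. length l = m \<and> set l \<subseteq> pverts G}"

text \<open>
  The weights below sum to one as soon as some walker sits on a vertex of positive degree, which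
  is the case for every state of a connected non-bipartite graph with at least one walker.
  Walkers are indexed from 0.
\<close>

definition fs_walker :: "'a pair_pre_digraph \<Rightarrow> 'a list \<Rightarrow> nat pmf" where
  "fs_walker G l = embed_pmf (\<lambda>i.
     if i < length l then real (deg G (l ! i)) / (\<Sum>j<length l. real (deg G (l ! j))) else 0)"

definition fs_step :: "'a pair_pre_digraph \<Rightarrow> 'a list \<Rightarrow> ('a list \<times> ('a \<times> 'a)) pmf" where
  "fs_step G l =
     bind_pmf (fs_walker G l) (\<lambda>i.
     bind_pmf (pmf_of_set (out_arcs (with_proj G) (l ! i))) (\<lambda>e.
     return_pmf (l[i := snd e], e)))"

definition fs_stationary :: "'a pair_pre_digraph \<Rightarrow> nat \<Rightarrow> 'a list pmf \<Rightarrow> bool" where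
  "fs_stationary G m p \<longleftrightarrow>
     set_pmf p \<subseteq> fs_states G m \<and> bind_pmf p (\<lambda>l. map_pmf fst (fs_step G l)) = p"

text \<open>
  \<open>L n\<close> is the state after \<open>n\<close> steps and \<open>X n\<close> the edge sampled by the step from \<open>L n\<close> to
  \<open>L (Suc n)\<close>. The assumption \<open>step\<close> says that, given the whole history up to time \<open>n\<close>, the pair
  \<open>(L (Suc n), X n)\<close> has law \<open>fs_step G (L n)\<close>; it is multiplied out to avoid conditioning on
  histories of probability zero.
\<close>

locale frontier_sampling = prob_space M
  for G :: "'a pair_pre_digraph" and m :: nat and M :: "'w measure"
    and L :: "nat \<Rightarrow> 'w \<Rightarrow> 'a list" and X :: "nat \<Rightarrow> 'w \<Rightarrow> 'a \<times> 'a" +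
  assumes random_variable_L: "\<And>n. random_variable (count_space UNIV) (L n)"
    and random_variable_X: "\<And>n. random_variable (count_space UNIV) (X n)"
    and init: "AE \<omega> in M. L 0 \<omega> \<in> fs_states G m"
    and step: "\<And>n ls es.
      prob {\<omega> \<in> space M. (\<forall>k\<le>Suc n. L k \<omega> = ls k) \<and> (\<forall>k\<le>n. X k \<omega> = es k)} =
      prob {\<omega> \<in> space M. (\<forall>k\<le>n. L k \<omega> = ls k) \<and> (\<forall>k<n. X k \<omega> = es k)} *
        pmf (fs_step G (ls n)) (ls (Suc n), es n)"

definition fs_steady_state :: "'a pair_pre_digraph \<Rightarrow> nat \<Rightarrow> 'w measure \<Rightarrow>
    (nat \<Rightarrow> 'w \<Rightarrow> 'a list) \<Rightarrow> (nat \<Rightarrow> 'w \<Rightarrow> 'a \<times> 'a) \<Rightarrow> bool" where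
  "fs_steady_state G m M L X \<longleftrightarrow> frontier_sampling G m M L X \<and>
     (\<exists>p. fs_stationary G m p \<and> distr M (count_space UNIV) (L 0) = measure_pmf p)"

definition stationary_sequence :: "'w measure \<Rightarrow> 'b measure \<Rightarrow> (nat \<Rightarrow> 'w \<Rightarrow> 'b) \<Rightarrow> bool" where
  "stationary_sequence M S X \<longleftrightarrow>
     (\<forall>k. distr M (\<Pi>\<^sub>M n\<in>UNIV. S) (\<lambda>\<omega> n. X (n + k) \<omega>) = distr M (\<Pi>\<^sub>M n\<in>UNIV. S) (\<lambda>\<omega> n. X n \<omega>))"

definition num_hits :: "(nat \<Rightarrow> 'b) \<Rightarrow> 'b set \<Rightarrow> nat \<Rightarrow> nat" where
  "num_hits x S B = card {n. n < B \<and> x n \<in> S}"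

text \<open>Hits are indexed from 0; \<open>nth_hit x S i\<close> is meaningful if there are more than \<open>i\<close> hits.\<close>

definition nth_hit :: "(nat \<Rightarrow> 'b) \<Rightarrow> 'b set \<Rightarrow> nat \<Rightarrow> 'b" where
  "nth_hit x S i = x (enumerate {n. x n \<in> S} i)"

end

theory Submission
  imports Defs "HOL-Real_Asymp.Real_Asymp" "HOL-Library.Discrete_Functions"
begin

text \<open>
  Frontier sampling is the simple random walk on the \<open>m\<close>-th Cartesian power of \<open>G\<close>, a finite
  connected graph in which the state \<open>l\<close> has degree \<open>d l = (\<Sum>i<m. deg (l ! i))\<close>. The law
  proportional to \<open>d\<close> is reversible. Under it every sampled edge is uniform, since an edge
  \<open>(u, v)\<close> is drawn from \<open>l\<close> with probability \<open>1 / d l\<close> for each walker at \<open>u\<close>.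

  Uniqueness and ergodicity both come from the Dirichlet energy. If \<open>c\<close> is a stationary law, then
  \<open>c l / d l\<close> is harmonic, so its energy vanishes and it is constant by connectedness. For the
  strong law, the increments of the indicator of a state (or an edge) minus its conditional
  probability are bounded and orthogonal, so their averages tend to 0 almost surely. Hence the
  empirical distribution of the states is asymptotically stationary, and the same energy argument,
  applied along the sequence, forces it to converge to the stationary law; the edge frequencies
  then converge to \<open>1 / card E\<close>.
\<close>

subsection \<open>Harmonic functions and averages\<close>

text \<open>Summation by parts: after expanding the square, symmetry of \<open>w\<close> makes the
  two pure square terms equal. The right side pairs \<open>q\<close> with its Laplacian, so a small
  Laplacian forces a small energy.\<close>

lemma dirichlet_energy:
  fixes w :: "'b \<Rightarrow> 'b \<Rightarrow> real" and q :: "'b \<Rightarrow> real"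
  assumes sym: "\<And>x y. x \<in> S \<Longrightarrow> y \<in> S \<Longrightarrow> w x y = w y x"
  shows "(\<Sum>x\<in>S. \<Sum>y\<in>S. w x y * (q x - q y)\<^sup>2) =
    2 * (\<Sum>x\<in>S. q x * ((\<Sum>y\<in>S. w x y) * q x - (\<Sum>y\<in>S. w x y * q y)))"
proof -
  have swap: "(\<Sum>x\<in>S. \<Sum>y\<in>S. w x y * (q y)\<^sup>2) = (\<Sum>x\<in>S. \<Sum>y\<in>S. w x y * (q x)\<^sup>2)"
    by (subst sum.swap) (intro sum.cong refl, simp add: sym)
  have "(\<Sum>x\<in>S. \<Sum>y\<in>S. w x y * (q x - q y)\<^sup>2) =
      (\<Sum>x\<in>S. \<Sum>y\<in>S. w x y * (q x)\<^sup>2) + (\<Sum>x\<in>S. \<Sum>y\<in>S. w x y * (q y)\<^sup>2)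
        - 2 * (\<Sum>x\<in>S. \<Sum>y\<in>S. q x * (w x y * q y))"
    by (simp add: power2_diff algebra_simps sum.distrib sum_subtractf sum_distrib_left)
  also have "\<dots> = 2 * ((\<Sum>x\<in>S. \<Sum>y\<in>S. w x y * (q x)\<^sup>2) - (\<Sum>x\<in>S. \<Sum>y\<in>S. q x * (w x y * q y)))"
    by (simp add: swap)
  also have "\<dots> = 2 * (\<Sum>x\<in>S. q x * ((\<Sum>y\<in>S. w x y) * q x - (\<Sum>y\<in>S. w x y * q y)))"
    by (simp add: sum_subtractf right_diff_distrib sum_distrib_left sum_distrib_right
        power2_eq_square mult_ac)
  finally show ?thesis .
qed

text \<open>
  The Dirichlet energy vanishes in the limit, hence so does the difference along every edge of
  positive weight.
\<close>

lemma asymptotically_harmonic_imp_constant: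
  fixes w :: "'b \<Rightarrow> 'b \<Rightarrow> real" and q :: "nat \<Rightarrow> 'b \<Rightarrow> real"
  assumes fin: "finite S"
    and nonneg: "\<And>x y. x \<in> S \<Longrightarrow> y \<in> S \<Longrightarrow> w x y \<ge> 0"
    and sym: "\<And>x y. x \<in> S \<Longrightarrow> y \<in> S \<Longrightarrow> w x y = w y x"
    and bdd: "\<And>x. x \<in> S \<Longrightarrow> Bseq (\<lambda>n. q n x)"
    and harm: "\<And>x. x \<in> S \<Longrightarrow>
      (\<lambda>n. (\<Sum>y\<in>S. w x y) * q n x - (\<Sum>y\<in>S. w x y * q n y)) \<longlonglongrightarrow> 0"
    and conn: "(a, b) \<in> {(x, y). x \<in> S \<and> y \<in> S \<and> w x y > 0}\<^sup>*"
  shows "(\<lambda>n. q n a - q n b) \<longlonglongrightarrow> 0"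
proof -
  let ?E = "\<lambda>n. \<Sum>x\<in>S. \<Sum>y\<in>S. w x y * (q n x - q n y)\<^sup>2"
  \<comment> \<open>Each summand is a bounded sequence times a null sequence.\<close>
  have "(\<lambda>n. 2 * (\<Sum>x\<in>S. q n x * ((\<Sum>y\<in>S. w x y) * q n x - (\<Sum>y\<in>S. w x y * q n y)))) \<longlonglongrightarrow> 2 * (\<Sum>x\<in>S. 0)"
  proof (intro tendsto_mult[OF tendsto_const] tendsto_sum)
    show "(\<lambda>n. q n x * ((\<Sum>y\<in>S. w x y) * q n x - (\<Sum>y\<in>S. w x y * q n y))) \<longlonglongrightarrow> 0"
      if "x \<in> S" for x
      using bounded_bilinear.Bfun_prod_Zfun[OF bounded_bilinear_mult bdd[OF that]] harm[OF that]
      by (simp add: tendsto_Zfun_iff)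
  qed
  then have E: "?E \<longlonglongrightarrow> 0"
    using dirichlet_energy[of S w, OF sym] by simp
  have step: "(\<lambda>n. q n x - q n y) \<longlonglongrightarrow> 0" if xy: "x \<in> S" "y \<in> S" "w x y > 0" for x y
  proof -
    \<comment> \<open>All energy terms are nonnegative, so a single edge is dominated by the whole
      energy.\<close>
    have le: "w x y * (q n x - q n y)\<^sup>2 \<le> ?E n" for n
    proof -
      have "w x y * (q n x - q n y)\<^sup>2 \<le> (\<Sum>z\<in>S. w x z * (q n x - q n z)\<^sup>2)"
        by (rule member_le_sum) (use xy fin nonneg in auto)
      also have "\<dots> \<le> ?E n"
        by (rule member_le_sum[where f = "\<lambda>x. \<Sum>z\<in>S. w x z * (q n x - q n z)\<^sup>2"])
           (use xy fin nonneg in \<open>auto intro!: sum_nonneg\<close>)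
      finally show ?thesis .
    qed
    have "(\<lambda>n. w x y * (q n x - q n y)\<^sup>2) \<longlonglongrightarrow> 0"
      by (rule tendsto_sandwich[OF _ _ tendsto_const E]) (use le xy in auto)
    then have "(\<lambda>n. (q n x - q n y)\<^sup>2) \<longlonglongrightarrow> 0"
      using xy(3) tendsto_mult_left_iff[of "w x y" "\<lambda>n. (q n x - q n y)\<^sup>2" 0] by simp
    then have "(\<lambda>n. sqrt ((q n x - q n y)\<^sup>2)) \<longlonglongrightarrow> sqrt 0"
      by (rule tendsto_real_sqrt)
    then show ?thesis
      by (simp add: tendsto_rabs_zero_iff)
  qed
  show ?thesis using conn
  proof (induction rule: rtrancl_induct)
    case base
    then show ?case by simp
  next
    case (step y z)
    then have "(\<lambda>n. (q n a - q n y) + (q n y - q n z)) \<longlonglongrightarrow> 0 + 0"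
      by (intro tendsto_add) (use \<open>\<And>x y. _ \<Longrightarrow> _ \<Longrightarrow> _ \<Longrightarrow> (\<lambda>n. q n x - q n y) \<longlonglongrightarrow> 0\<close> in auto)
    then show ?case by simp
  qed
qed

text \<open>
  The partial sums have variance at most \<open>C\<^sup>2 n\<close>, which is summable after normalisation along
  the squares \<open>n = k\<^sup>2\<close>; between consecutive squares they vary by at most \<open>2 C k\<close>.
\<close>

lemma (in prob_space) slln_bounded_orthogonal:
  fixes D :: "nat \<Rightarrow> 'a \<Rightarrow> real"
  assumes meas [measurable]: "\<And>n. D n \<in> borel_measurable M"
    and bdd: "\<And>n \<omega>. \<bar>D n \<omega>\<bar> \<le> C"
    and orth: "\<And>i j. i < j \<Longrightarrow> expectation (\<lambda>\<omega>. D i \<omega> * D j \<omega>) = 0"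
  shows "AE \<omega> in M. (\<lambda>n. (\<Sum>k<n. D k \<omega>) / real n) \<longlonglongrightarrow> 0"
proof -
  define S where "S n \<omega> = (\<Sum>k<n. D k \<omega>)" for n \<omega>
  have [measurable]: "S n \<in> borel_measurable M" for n
    unfolding S_def by measurable
  have C: "C \<ge> 0" using bdd[of 0 undefined] by linarith
  have DD: "integrable M (\<lambda>\<omega>. D i \<omega> * D j \<omega>)" for i j
    by (rule integrable_const_bound[where B = "C * C"])
       (auto simp: abs_mult intro!: mult_mono bdd C)
  have SD: "expectation (\<lambda>\<omega>. S n \<omega> * D n \<omega>) = 0" for n
    unfolding S_def sum_distrib_right
    by (subst Bochner_Integration.integral_sum) (auto simp: DD orth)
  have int_S2: "integrable M (\<lambda>\<omega>. (S n \<omega>)\<^sup>2)" for n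
    unfolding S_def power2_eq_square sum_product by (intro Bochner_Integration.integrable_sum DD)
  have int_SD: "integrable M (\<lambda>\<omega>. S n \<omega> * D n \<omega>)" for n
    unfolding S_def sum_distrib_right by (intro Bochner_Integration.integrable_sum DD)
  \<comment> \<open>Orthogonality removes the cross term, so each new summand adds at most
    \<open>C * C\<close>.\<close>
  have var: "expectation (\<lambda>\<omega>. (S n \<omega>)\<^sup>2) \<le> C\<^sup>2 * n" for n
  proof (induction n)
    case 0
    then show ?case by (simp add: S_def)
  next
    case (Suc n)
    have "expectation (\<lambda>\<omega>. (S (Suc n) \<omega>)\<^sup>2)
        = expectation (\<lambda>\<omega>. (S n \<omega>)\<^sup>2 + 2 * (S n \<omega> * D n \<omega>) + D n \<omega> * D n \<omega>)"
      by (simp add: S_def power2_sum power2_eq_square algebra_simps)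
    also have "\<dots> = expectation (\<lambda>\<omega>. (S n \<omega>)\<^sup>2) + expectation (\<lambda>\<omega>. D n \<omega> * D n \<omega>)"
      using int_S2 int_SD DD by (simp add: SD)
    also have "expectation (\<lambda>\<omega>. D n \<omega> * D n \<omega>) \<le> expectation (\<lambda>\<omega>. C\<^sup>2)"
    proof (intro integral_mono DD)
      show "D n \<omega> * D n \<omega> \<le> C\<^sup>2" for \<omega>
        using bdd[of n \<omega>] by (metis abs_le_square_iff abs_of_nonneg C power2_eq_square)
    qed auto
    finally show ?case using Suc by (simp add: algebra_simps prob_space)
  qed
  \<comment> \<open>Normalised squares along (k+1)^2; the shift by one avoids division by zero. The
    variance bound gives C^2 (k+1)^2 / (k+1)^4 = C^2 / (k+1)^2.\<close>
  define Y where "Y k \<omega> = (S ((Suc k)\<^sup>2) \<omega> / (real (Suc k))\<^sup>2)\<^sup>2" for k \<omega>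
  have [measurable]: "Y k \<in> borel_measurable M" for k unfolding Y_def by measurable
  have int_Y: "integrable M (Y k)" for k
    unfolding Y_def power_divide using int_S2 by simp
  have EY: "expectation (Y k) \<le> C\<^sup>2 / (real (Suc k))\<^sup>2" for k
  proof -
    have "expectation (Y k) = expectation (\<lambda>\<omega>. (S ((Suc k)\<^sup>2) \<omega>)\<^sup>2) / ((real (Suc k))\<^sup>2)\<^sup>2"
      unfolding Y_def power_divide by simp
    also have "\<dots> \<le> (C\<^sup>2 * real ((Suc k)\<^sup>2)) / ((real (Suc k))\<^sup>2)\<^sup>2"
      by (intro divide_right_mono var) auto
    also have "\<dots> = C\<^sup>2 / (real (Suc k))\<^sup>2"
    proof -
      have "C\<^sup>2 * t\<^sup>2 / (t\<^sup>2)\<^sup>2 = C\<^sup>2 / t\<^sup>2" for t :: real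
        by (cases "t = 0") (simp_all add: field_simps flip: power_add)
      then show ?thesis by (simp only: of_nat_power)
    qed
    finally show ?thesis .
  qed
  have summ: "summable (\<lambda>k. C\<^sup>2 / (real (Suc k))\<^sup>2)"
    using inverse_power_summable[of 2, where 'a = real]
    by (subst divide_inverse, intro summable_mult, subst summable_Suc_iff[of "\<lambda>k. inverse ((real k)\<^sup>2)"])
       (auto simp: inverse_eq_divide)
  \<comment> \<open>The expectations are summable, so almost surely the series of the
    \<open>Y k\<close> converges and its terms tend to 0.\<close>
  have "(\<integral>\<^sup>+ \<omega>. (\<Sum>k. ennreal (Y k \<omega>)) \<partial>M) = (\<Sum>k. \<integral>\<^sup>+ \<omega>. ennreal (Y k \<omega>) \<partial>M)"
    by (rule nn_integral_suminf) measurable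
  also have "\<dots> = (\<Sum>k. ennreal (expectation (Y k)))"
    by (intro suminf_cong nn_integral_eq_integral int_Y) (simp add: Y_def)
  also have "\<dots> \<le> (\<Sum>k. ennreal (C\<^sup>2 / (real (Suc k))\<^sup>2))"
    by (intro suminf_le ennreal_leI EY) auto
  also have "\<dots> < \<infinity>"
    by (subst suminf_ennreal2[OF _ summ]) auto
  finally have "AE \<omega> in M. (\<Sum>k. ennreal (Y k \<omega>)) \<noteq> \<infinity>"
    by (intro nn_integral_noteq_infinite) auto
  then show ?thesis
  proof eventually_elim
    case (elim \<omega>)
    then have "summable (\<lambda>k. Y k \<omega>)"
      by (intro summable_suminf_not_top) (auto simp: Y_def)
    then have "(\<lambda>k. Y k \<omega>) \<longlonglongrightarrow> 0"
      by (rule summable_LIMSEQ_zero)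
    then have "(\<lambda>k. sqrt (Y k \<omega>)) \<longlonglongrightarrow> sqrt 0"
      by (rule tendsto_real_sqrt)
    then have "(\<lambda>k. \<bar>S ((Suc k)\<^sup>2) \<omega> / (real (Suc k))\<^sup>2\<bar>) \<longlonglongrightarrow> 0"
      unfolding Y_def real_sqrt_abs by simp
    then have lim1: "(\<lambda>k. \<bar>S (k\<^sup>2) \<omega> / (real k)\<^sup>2\<bar>) \<longlonglongrightarrow> 0"
      by (rule filterlim_sequentially_Suc[THEN iffD1])
    have "(\<lambda>k. C * (2 * real k) / (real k)\<^sup>2) \<longlonglongrightarrow> 0"
      by real_asymp
    from tendsto_add[OF lim1 this]
    have lim2: "(\<lambda>k. \<bar>S (k\<^sup>2) \<omega> / (real k)\<^sup>2\<bar> + C * (2 * real k) / (real k)\<^sup>2) \<longlonglongrightarrow> 0"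
      by simp
    \<comment> \<open>This transfers the limit along squares to all n through the largest square
      below n.\<close>
    have fs: "filterlim floor_sqrt sequentially sequentially"
      unfolding filterlim_at_top
    proof
      fix Z :: nat
      show "\<forall>\<^sub>F n in sequentially. Z \<le> floor_sqrt n"
        using eventually_ge_at_top[of "Z\<^sup>2"]
        by eventually_elim (metis mono_floor_sqrt' floor_sqrt_inverse_power2)
    qed
    have "\<forall>\<^sub>F n in sequentially. norm (S n \<omega> / real n) \<le>
        \<bar>S ((floor_sqrt n)\<^sup>2) \<omega> / (real (floor_sqrt n))\<^sup>2\<bar> + C * (2 * real (floor_sqrt n)) / (real (floor_sqrt n))\<^sup>2"
      using eventually_gt_at_top[of 0]
    proof eventually_elim
      case (elim n)
      define k where "k = floor_sqrt n"
      have k: "k > 0" "k\<^sup>2 \<le> n" "n < (Suc k)\<^sup>2"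
        using elim by (auto simp: k_def Suc_floor_sqrt_power2_gt)
      have "S n \<omega> = S (k\<^sup>2) \<omega> + (\<Sum>j=k\<^sup>2..<n. D j \<omega>)"
        unfolding S_def lessThan_atLeast0 using k by (simp add: sum.atLeastLessThan_concat)
      \<comment> \<open>From n < (k+1)^2 at most 2k summands lie beyond k^2.\<close>
      moreover have "\<bar>\<Sum>j=k\<^sup>2..<n. D j \<omega>\<bar> \<le> C * (2 * k)"
      proof -
        have "\<bar>\<Sum>j=k\<^sup>2..<n. D j \<omega>\<bar> \<le> (\<Sum>j=k\<^sup>2..<n. \<bar>D j \<omega>\<bar>)" by (rule sum_abs)
        also have "\<dots> \<le> (\<Sum>j=k\<^sup>2..<n. C)" by (intro sum_mono bdd)
        also have "\<dots> = C * real (n - k\<^sup>2)" by (simp add: mult.commute)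
        also have "\<dots> \<le> C * real (2 * k)"
          using k(3) by (intro mult_left_mono C of_nat_mono) (simp add: power2_eq_square)
        finally show ?thesis by simp
      qed
      ultimately have "\<bar>S n \<omega>\<bar> \<le> \<bar>S (k\<^sup>2) \<omega>\<bar> + C * (2 * k)" by linarith
      then have "\<bar>S n \<omega>\<bar> / real n \<le> (\<bar>S (k\<^sup>2) \<omega>\<bar> + C * (2 * k)) / (real k)\<^sup>2"
        using k C by (intro frac_le) (auto simp flip: of_nat_power)
      then show ?case by (simp add: k_def add_divide_distrib)
    qed
    then have "(\<lambda>n. S n \<omega> / real n) \<longlonglongrightarrow> 0"
      by (rule Lim_null_comparison) (rule filterlim_compose[OF lim2 fs])
    then show ?case by (simp add: S_def)
  qed
qed

section \<open>Time averages and averages over hits\<close>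

text \<open>The enumeration is strictly increasing and starts at index 0, so the elements below its
  i-th value are exactly the first i values.\<close>

lemma enumerate_card_less:
  fixes T :: "nat set"
  assumes "infinite T" "n \<in> T"
  shows "enumerate T (card {k \<in> T. k < n}) = n"
proof -
  obtain i where i: "n = enumerate T i"
    using enumerate_Ex[OF assms] by metis
  have "{k \<in> T. k < n} = enumerate T ` {..<i}"
    using assms(1) enumerate_Ex[OF assms(1)] unfolding i
    by (auto simp: enumerate_in_set) (metis enumerate_mono_iff imageI lessThan_iff)
  then have "card {k \<in> T. k < n} = i"
    using inj_enumerate[OF assms(1)] by (simp add: card_image inj_on_subset)
  then show ?thesis using i by simp
qed

text \<open>Converts a sum over hits into a sum over time. In the induction, a hit at time
  \<open>B\<close> has as its index the number of earlier hits.\<close>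

lemma sum_nth_hit:
  fixes f :: "'b \<Rightarrow> real"
  assumes inf: "infinite {n. x n \<in> S}"
  shows "(\<Sum>i<num_hits x S B. f (nth_hit x S i)) = (\<Sum>n<B. if x n \<in> S then f (x n) else 0)"
proof (induction B)
  case 0
  then show ?case by (simp add: num_hits_def)
next
  case (Suc B)
  have *: "{n. n < Suc B \<and> x n \<in> S} =
      (if x B \<in> S then insert B {n. n < B \<and> x n \<in> S} else {n. n < B \<and> x n \<in> S})"
    by (auto simp: less_Suc_eq)
  have nh: "num_hits x S (Suc B) = (if x B \<in> S then Suc (num_hits x S B) else num_hits x S B)"
    unfolding num_hits_def * by auto
  have "nth_hit x S (num_hits x S B) = x B" if "x B \<in> S"
    using enumerate_card_less[OF inf, of B] that unfolding nth_hit_def num_hits_def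
    by (simp add: conj_commute)
  with Suc nh show ?case by simp
qed

lemma sum_indicator_eq:
  fixes f :: "'b \<Rightarrow> real"
  assumes "finite S"
  shows "(\<Sum>n<B. if x n \<in> S then f (x n) else 0) = (\<Sum>e\<in>S. f e * (\<Sum>n<B. if x n = e then 1 else 0))"
proof -
  have "(if x n \<in> S then f (x n) else 0) = (\<Sum>e\<in>S. f e * (if x n = e then 1 else 0))" for n
    using assms by (simp add: sum.delta' if_distrib[of "(*) _"] cong: if_cong)
  then have "(\<Sum>n<B. if x n \<in> S then f (x n) else 0) =
      (\<Sum>n<B. \<Sum>e\<in>S. f e * (if x n = e then 1 else 0))"
    by simp
  also have "\<dots> = (\<Sum>e\<in>S. f e * (\<Sum>n<B. if x n = e then 1 else 0))"
    by (subst sum.swap) (simp add: sum_distrib_left)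
  finally show ?thesis .
qed

text \<open>Integrating \<open>f\<close> against the empirical distribution gives its time average,
  because the sequence never leaves \<open>S\<close>.\<close>

lemma sum_frequencies:
  fixes f :: "'b \<Rightarrow> real"
  assumes "finite S" "\<And>n. x n \<in> S"
  shows "(\<Sum>e\<in>S. (\<Sum>n<B. if x n = e then 1 else 0) / real B * f e) = (\<Sum>n<B. f (x n)) / real B"
  using sum_indicator_eq[OF assms(1), of x f B] assms(2)
  by (simp add: sum_divide_distrib[of _ S] mult.commute)

text \<open>The hit average is a quotient of two time averages, with limits \<open>c\<close> times
  the sum of \<open>f\<close> and \<open>c\<close> times \<open>card S\<close>; the factor
  \<open>c\<close> cancels.\<close>

lemma equal_frequencies_imp_hit_average:
  fixes f :: "'b \<Rightarrow> real"
  assumes fin: "finite S" and ne: "S \<noteq> {}" and c: "c > 0"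
    and freq: "\<And>e. e \<in> S \<Longrightarrow> (\<lambda>B. (\<Sum>n<B. if x n = e then 1 else 0) / real B) \<longlonglongrightarrow> c"
  shows "(\<lambda>B. 1 / real (num_hits x S B) * (\<Sum>i<num_hits x S B. f (nth_hit x S i)))
    \<longlonglongrightarrow> 1 / real (card S) * (\<Sum>e\<in>S. f e)"
proof -
  have avg: "(\<lambda>B. (\<Sum>n<B. if x n \<in> S then g (x n) else 0) / real B) \<longlonglongrightarrow> (\<Sum>e\<in>S. g e * c)"
    for g :: "'b \<Rightarrow> real"
  proof -
    have "(\<Sum>n<B. if x n \<in> S then g (x n) else 0) / real B =
        (\<Sum>e\<in>S. g e * ((\<Sum>n<B. if x n = e then 1 else 0) / real B))" for B
      by (simp add: sum_indicator_eq[OF fin] sum_divide_distrib[of _ S])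
    moreover have "(\<lambda>B. \<Sum>e\<in>S. g e * ((\<Sum>n<B. if x n = e then 1 else 0) / real B))
        \<longlonglongrightarrow> (\<Sum>e\<in>S. g e * c)"
      by (intro tendsto_sum tendsto_mult tendsto_const freq)
    ultimately show ?thesis by presburger
  qed
  have hits: "real (num_hits x S B) = (\<Sum>n<B. if x n \<in> S then 1 else 0)" for B
  proof -
    have "{n. n < B \<and> x n \<in> S} = {..<B} \<inter> {n. x n \<in> S}" by auto
    then show ?thesis unfolding num_hits_def by (simp add: sum.If_cases)
  qed
  have num: "(\<lambda>B. real (num_hits x S B) / real B) \<longlonglongrightarrow> real (card S) * c"
    using avg[of "\<lambda>_. 1"] unfolding hits by simp
  have pos: "real (card S) * c > 0" using fin ne c by (simp add: card_gt_0_iff)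
  \<comment> \<open>Finitely many hits would force hit frequency 0, against the positive
    limit.\<close>
  have inf: "infinite {n. x n \<in> S}"
  proof
    assume fin_hits: "finite {n. x n \<in> S}"
    have "real (num_hits x S B) \<le> real (card {n. x n \<in> S})" for B
      unfolding num_hits_def of_nat_le_iff by (rule card_mono[OF fin_hits]) auto
    then have "norm (real (num_hits x S B) / real B) \<le> real (card {n. x n \<in> S}) / real B" for B
      by (simp add: divide_right_mono)
    then have "(\<lambda>B. real (num_hits x S B) / real B) \<longlonglongrightarrow> 0"
      by (intro Lim_null_comparison[OF _ lim_const_over_n] always_eventually allI)
    with num pos LIMSEQ_unique show False by fastforce
  qed
  have lim: "(\<lambda>B. ((\<Sum>n<B. if x n \<in> S then f (x n) else 0) / real B) / (real (num_hits x S B) / real B))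
      \<longlonglongrightarrow> (\<Sum>e\<in>S. f e * c) / (real (card S) * c)"
    using pos by (intro tendsto_divide[OF avg num] less_imp_neq[symmetric])
  have val: "(\<Sum>e\<in>S. f e * c) / (real (card S) * c) = 1 / real (card S) * (\<Sum>e\<in>S. f e)"
    using c by (simp flip: sum_distrib_right)
  have "\<forall>\<^sub>F B in sequentially.
      ((\<Sum>n<B. if x n \<in> S then f (x n) else 0) / real B) / (real (num_hits x S B) / real B) =
      1 / real (num_hits x S B) * (\<Sum>i<num_hits x S B. f (nth_hit x S i))"
    using eventually_gt_at_top[of 0]
    by eventually_elim (simp add: sum_nth_hit[OF inf])
  then show ?thesis
    by (rule Lim_transform_eventually[OF lim[unfolded val]])
qed

subsection \<open>Discrete laws\<close>

lemma (in prob_space) prob_eq_expectation_indicator: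
  assumes "Z \<in> measurable M (count_space UNIV)"
  shows "prob {\<omega> \<in> space M. Z \<omega> \<in> A} = expectation (\<lambda>\<omega>. indicator A (Z \<omega>))"
proof -
  have "expectation (\<lambda>\<omega>. indicator A (Z \<omega>)) = expectation (indicator {\<omega> \<in> space M. Z \<omega> \<in> A})"
    by (intro Bochner_Integration.integral_cong) (auto split: split_indicator)
  also have "\<dots> = prob ({\<omega> \<in> space M. Z \<omega> \<in> A} \<inter> space M)"
    by (rule Bochner_Integration.integral_indicator)
  also have "{\<omega> \<in> space M. Z \<omega> \<in> A} \<inter> space M = {\<omega> \<in> space M. Z \<omega> \<in> A}"
    by auto
  finally show ?thesis ..
qed

lemma expectation_indicator_map:
  "measure_pmf.expectation q (\<lambda>z. if g z = y then 1 else 0 :: real) = pmf (map_pmf g q) y"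
proof -
  have "(\<lambda>z. if g z = y then 1 else 0 :: real) = indicator (g -` {y})"
    by (auto simp: fun_eq_iff split: split_indicator)
  then show ?thesis by (simp add: pmf_map)
qed

text \<open>The point masses of \<open>p\<close> live on a countable set, which bounds
  \<open>p\<close> by the distribution on every set. Both have total mass 1, so the same bound on
  the complement gives equality.\<close>

lemma (in prob_space) distr_eq_measure_pmfI:
  assumes X [measurable]: "random_variable (count_space UNIV) X"
    and eq: "\<And>x. prob {\<omega> \<in> space M. X \<omega> = x} = pmf p x"
  shows "distr M (count_space UNIV) X = measure_pmf p"
proof -
  interpret D: prob_space "distr M (count_space UNIV) X"
    by (rule prob_space_distr) simp
  have single: "emeasure (distr M (count_space UNIV) X) {x} = emeasure p {x}" for x
    by (subst emeasure_distr)
       (auto simp: emeasure_pmf_single emeasure_eq_measure vimage_def Int_def conj_commute simp flip: eq)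
  have le: "emeasure p A \<le> emeasure (distr M (count_space UNIV) X) A" for A
  proof -
    have "emeasure p A = emeasure p (A \<inter> set_pmf p)"
      by (simp add: emeasure_Int_set_pmf)
    also have "\<dots> = (\<integral>\<^sup>+ x. emeasure p {x} \<partial>count_space (A \<inter> set_pmf p))"
      by (rule emeasure_countable_singleton) (auto intro: countable_subset[OF _ countable_set_pmf])
    also have "\<dots> = (\<integral>\<^sup>+ x. emeasure (distr M (count_space UNIV) X) {x} \<partial>count_space (A \<inter> set_pmf p))"
      by (simp only: single)
    also have "\<dots> = emeasure (distr M (count_space UNIV) X) (A \<inter> set_pmf p)"
      by (rule emeasure_countable_singleton[symmetric]) (auto intro: countable_subset[OF _ countable_set_pmf])
    also have "\<dots> \<le> emeasure (distr M (count_space UNIV) X) A"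
      by (intro emeasure_mono) auto
    finally show ?thesis .
  qed
  show ?thesis
  proof (rule measure_eqI)
    fix A
    have le': "measure p B \<le> measure (distr M (count_space UNIV) X) B" for B
      using le[of B] by (simp add: D.emeasure_eq_measure measure_pmf.emeasure_eq_measure)
    have "measure (distr M (count_space UNIV) X) A = measure p A"
      using le'[of A] le'[of "- A"] D.prob_compl[of A] measure_pmf.prob_compl[of A p]
      by (simp add: Compl_eq_Diff_UNIV)
    then show "emeasure (distr M (count_space UNIV) X) A = emeasure p A"
      by (simp add: D.emeasure_eq_measure measure_pmf.emeasure_eq_measure)
  qed simp
qed

text \<open>Only the point events of \<open>X\<close> are assumed measurable. They carry total mass
  1 on the countable support of \<open>p\<close>, so \<open>X\<close> agrees almost surely with a
  discrete random variable \<open>Y\<close>, to which the usual transfer of integrals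
  applies.\<close>

lemma (in prob_space) expectation_eq_pmf:
  fixes f :: "'b \<Rightarrow> real"
  assumes event: "\<And>x. {\<omega> \<in> space M. X \<omega> = x} \<in> events"
    and eq: "\<And>x. prob {\<omega> \<in> space M. X \<omega> = x} = pmf p x"
    and f: "(\<lambda>\<omega>. f (X \<omega>)) \<in> borel_measurable M"
  shows "expectation (\<lambda>\<omega>. f (X \<omega>)) = measure_pmf.expectation p f"
proof -
  let ?B = "{\<omega> \<in> space M. X \<omega> \<in> set_pmf p}"
  have union: "{\<omega> \<in> space M. X \<omega> \<in> A \<and> X \<omega> \<in> set_pmf p} = (\<Union>x\<in>A \<inter> set_pmf p. {\<omega> \<in> space M. X \<omega> = x})"
    for A by auto
  have meas: "{\<omega> \<in> space M. X \<omega> \<in> A \<and> X \<omega> \<in> set_pmf p} \<in> events" for A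
    unfolding union by (intro sets.countable_UN'' event) (auto intro: countable_subset[OF _ countable_set_pmf])
  have B: "?B \<in> events" using meas[of UNIV] by simp
  have "emeasure M ?B = emeasure M (\<Union>x\<in>set_pmf p. {\<omega> \<in> space M. X \<omega> = x})"
    by (rule arg_cong[of _ _ "emeasure M"]) auto
  also have "\<dots> = (\<integral>\<^sup>+ x. emeasure M {\<omega> \<in> space M. X \<omega> = x} \<partial>count_space (set_pmf p))"
    by (rule emeasure_UN_countable) (auto simp: event disjoint_family_on_def)
  also have "\<dots> = emeasure p (set_pmf p)"
    by (simp add: emeasure_eq_measure eq nn_integral_pmf)
  also have "\<dots> = 1"
    by (simp add: measure_pmf.emeasure_eq_measure measure_pmf.prob_eq_1 AE_measure_pmf)
  finally have "prob ?B = 1" by (simp add: emeasure_eq_measure)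
  then have AE: "AE \<omega> in M. X \<omega> \<in> set_pmf p"
    by (simp add: prob_Collect_eq_1[OF B])
  obtain x0 where x0: "x0 \<in> set_pmf p" using set_pmf_not_empty by fast
  \<comment> \<open>Off the support \<open>Y\<close> is a fixed support point, so its preimages are
    built from countable unions of point events and the complement of \<open>?B\<close>.\<close>
  define Y where "Y \<omega> = (if X \<omega> \<in> set_pmf p then X \<omega> else x0)" for \<omega>
  have XY: "AE \<omega> in M. X \<omega> = Y \<omega>" using AE by eventually_elim (simp add: Y_def)
  have Y: "Y \<in> measurable M (count_space UNIV)"
  proof (rule measurableI)
    fix A
    have "Y -` A \<inter> space M = {\<omega> \<in> space M. X \<omega> \<in> A \<and> X \<omega> \<in> set_pmf p} \<union> (if x0 \<in> A then space M - ?B else {})"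
      by (auto simp: Y_def split: if_splits)
    also have "\<dots> \<in> events" using meas[of A] B by auto
    finally show "Y -` A \<inter> space M \<in> events" .
  qed simp
  have "prob {\<omega> \<in> space M. Y \<omega> = x} = prob {\<omega> \<in> space M. X \<omega> = x}" for x
    using Y XY by (intro measure_eq_AE) (auto simp: event)
  then have distr: "distr M (count_space UNIV) Y = measure_pmf p"
    by (intro distr_eq_measure_pmfI Y) (simp add: eq)
  have "expectation (\<lambda>\<omega>. f (X \<omega>)) = expectation (\<lambda>\<omega>. f (Y \<omega>))"
  proof (intro integral_cong_AE f)
    show "(\<lambda>\<omega>. f (Y \<omega>)) \<in> borel_measurable M"
      by (rule measurable_compose[OF Y]) simp
    show "AE \<omega> in M. f (X \<omega>) = f (Y \<omega>)" using XY by eventually_elim simp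
  qed
  also have "\<dots> = (\<integral>x. f x \<partial>distr M (count_space UNIV) Y)"
    by (rule integral_distr[symmetric, OF Y]) simp
  finally show ?thesis
    unfolding distr .
qed

lemma integral_bind_pmf_bounded:
  fixes f :: "'b \<Rightarrow> real"
  assumes bdd: "\<And>x. \<bar>f x\<bar> \<le> C"
  shows "measure_pmf.expectation (bind_pmf p N) f =
    measure_pmf.expectation p (\<lambda>x. measure_pmf.expectation (N x) f)"
  unfolding measure_pmf_bind
  by (rule integral_bind[where K = "count_space UNIV" and B' = 1 and B = C])
     (use bdd in \<open>auto intro: measure_pmf_in_subprob_space\<close>)

subsection \<open>The walk on the Cartesian power\<close>

text \<open>Each element of \<open>A\<close> stands at position \<open>i\<close> in
  \<open>card A ^ (n - 1)\<close> of the lists. The induction splits off the head, which is either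
  the inspected entry or a free factor \<open>card A\<close>.\<close>

lemma sum_lists_nth:
  fixes f :: "'b \<Rightarrow> real"
  assumes "finite A" "i < n"
  shows "(\<Sum>l | length l = n \<and> set l \<subseteq> A. f (l ! i)) = real (card A) ^ (n - 1) * (\<Sum>v\<in>A. f v)"
  using assms(2)
proof (induction n arbitrary: i)
  case 0
  then show ?case by simp
next
  case (Suc n)
  let ?L = "{l. length l = n \<and> set l \<subseteq> A}"
  have card: "card ?L = card A ^ n"
    using card_lists_length_eq[OF assms(1), of n] by (simp add: conj_commute)
  have "{l. length l = Suc n \<and> set l \<subseteq> A} = (\<lambda>(v, l). v # l) ` (A \<times> ?L)"
    by (force simp: length_Suc_conv image_iff)
  then have "(\<Sum>l | length l = Suc n \<and> set l \<subseteq> A. f (l ! i)) = (\<Sum>(v, l)\<in>A \<times> ?L. f ((v # l) ! i))"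
    by (simp add: sum.reindex inj_on_def case_prod_unfold)
  also have "\<dots> = (\<Sum>v\<in>A. \<Sum>l\<in>?L. f ((v # l) ! i))"
    by (simp add: sum.cartesian_product)
  also have "\<dots> = real (card A) ^ n * (\<Sum>v\<in>A. f v)"
  proof (cases i)
    case 0
    then show ?thesis by (simp add: card flip: sum_distrib_left)
  next
    case i: (Suc j)
    then have "j < n" using Suc.prems by simp
    then have "real (card A) * real (card A) ^ (n - 1) = real (card A) ^ n"
      by (cases n) auto
    then show ?thesis
      using Suc.IH[OF \<open>j < n\<close>] by (simp add: i flip: mult.assoc)
  qed
  finally show ?case by simp
qed

locale frontier_graph = pair_pseudo_graph G for G :: "'a pair_pre_digraph" +
  fixes m :: nat
  assumes connected: "Digraph_Component.connected (with_proj G)"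
    and non_bipartite: "\<not> bipartite G"
    and m_pos: "m \<ge> 1"
begin

abbreviation "V \<equiv> pverts G"
abbreviation "E \<equiv> parcs G"
abbreviation "S \<equiv> fs_states G m"

text \<open>
  In the \<open>m\<close>-th Cartesian power of the graph, \<open>w x y\<close> is the number of edges from \<open>x\<close> to \<open>y\<close>
  and \<open>d x\<close> is the degree of \<open>x\<close>.
\<close>

definition w :: "'a list \<Rightarrow> 'a list \<Rightarrow> real" where
  "w x y = (\<Sum>i<m. \<Sum>e\<in>E. if fst e = x ! i \<and> y = x[i := snd e] then 1 else 0)"

definition d :: "'a list \<Rightarrow> real" where
  "d x = (\<Sum>i<m. real (deg G (x ! i)))"

text \<open>Total degree of the power graph, the normalising constant of the stationary law
  \<open>d x / D\<close>.\<close>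

definition D :: real where
  "D = (\<Sum>x\<in>S. d x)"

section \<open>Vertices, degrees and edges of the power\<close>

lemma finite_S: "finite S"
  unfolding fs_states_def using finite_lists_length_eq[OF pair_finite_verts, of m]
  by (simp add: conj_commute)

lemma E_subset: "(u, v) \<in> E \<Longrightarrow> u \<in> V" "(u, v) \<in> E \<Longrightarrow> v \<in> V"
  using arc_fst_in_verts arc_snd_in_verts by fastforce+

text \<open>\<open>connected\<close> concerns the symmetric closure of the arcs; since the arcs are
  symmetric, directed paths follow.\<close>

lemma E_rtrancl:
  assumes "u \<in> V" "v \<in> V"
  shows "(u, v) \<in> E\<^sup>*"
proof -
  have "strongly_connected (with_proj G)"
    using connected sym_arcs by (intro symmetric_connected_imp_strongly_connected)
  then have "u \<rightarrow>\<^sup>*\<^bsub>with_proj G\<^esub> v"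
    using assms by (auto simp: strongly_connected_def)
  then show ?thesis
    by (auto simp: reachable_def dest: rtrancl_on_rtranclI)
qed

lemma V_nonempty: "V \<noteq> {}"
  using connected by (auto simp: connected_def strongly_connected_def)

lemma out_arcs_eq: "out_arcs (with_proj G) v = {e \<in> E. fst e = v}"
  by (auto simp: out_arcs_def)

lemma deg_eq_card: "deg G v = card {e \<in> E. fst e = v}"
  by (simp add: deg_def out_degree_def out_arcs_eq)

text \<open>By connectedness, a vertex without outgoing arcs would be the only vertex. Then there
  are no arcs at all, and \<open>V\<close> with the empty set is a bipartition.\<close>

lemma deg_pos:
  assumes v: "v \<in> V"
  shows "deg G v > 0"
proof (rule ccontr)
  assume "\<not> deg G v > 0"
  then have no_out: "{e \<in> E. fst e = v} = {}"
    using pair_finite_arcs by (simp add: deg_eq_card)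
  have "u = v" if "u \<in> V" for u
    using E_rtrancl[OF v that] no_out by (auto elim: converse_rtranclE)
  then have "E = {}"
    using no_out by (fastforce dest: E_subset)
  then have "bipartite G"
    unfolding bipartite_def by (intro exI[of _ V] exI[of _ "{}"]) auto
  with non_bipartite show False ..
qed

lemma S_nth: "x \<in> S \<Longrightarrow> i < m \<Longrightarrow> x ! i \<in> V"
  by (auto simp: fs_states_def)

lemma S_update: "x \<in> S \<Longrightarrow> v \<in> V \<Longrightarrow> x[i := v] \<in> S"
  using set_update_subset_insert[of x i v] by (auto simp: fs_states_def)

lemma d_pos:
  assumes "x \<in> S"
  shows "d x > 0"
  unfolding d_def using assms m_pos
  by (intro sum_pos) (auto intro!: deg_pos S_nth simp: lessThan_empty_iff)

lemma w_nonneg: "w x y \<ge> 0"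
  unfolding w_def by (intro sum_nonneg) auto

lemma w_outside:
  assumes "x \<in> S" "y \<notin> S"
  shows "w x y = 0"
  unfolding w_def using assms
  by (intro sum.neutral ballI) (auto dest: E_subset S_update)

text \<open>Reversing the edge used by walker \<open>i\<close> undoes the move, and reversal is a
  bijection of \<open>E\<close>.\<close>

lemma w_sym:
  assumes "x \<in> S" "y \<in> S"
  shows "w x y = w y x"
  unfolding w_def
proof (rule sum.cong[OF refl])
  fix i assume "i \<in> {..<m}"
  then have i: "i < length x" "i < length y"
    using assms by (auto simp: fs_states_def)
  have E_swap: "prod.swap ` E = E"
    using arcs_symmetric by (force simp: image_iff)
  have "(\<Sum>e\<in>E. if fst e = x ! i \<and> y = x[i := snd e] then 1 else 0 :: real) =
      (\<Sum>e\<in>prod.swap ` E. if fst e = x ! i \<and> y = x[i := snd e] then 1 else 0)"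
    by (simp only: E_swap)
  also have "\<dots> = (\<Sum>e\<in>E. if snd e = x ! i \<and> y = x[i := fst e] then 1 else 0)"
    by (subst sum.reindex) auto
  \<comment> \<open>Both conditions say that \<open>x\<close> and \<open>y\<close> agree off
    position \<open>i\<close> and that \<open>e\<close> runs from \<open>y ! i\<close> to
    \<open>x ! i\<close>.\<close>
  also have "\<dots> = (\<Sum>e\<in>E. if fst e = y ! i \<and> x = y[i := snd e] then 1 else 0)"
    using i by (intro sum.cong refl if_cong) auto
  finally show "(\<Sum>e\<in>E. if fst e = x ! i \<and> y = x[i := snd e] then 1 else 0 :: real) =
      (\<Sum>e\<in>E. if fst e = y ! i \<and> x = y[i := snd e] then 1 else 0)" .
qed

section \<open>Transition probabilities\<close>

lemma pmf_fs_walker: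
  assumes "x \<in> S"
  shows "pmf (fs_walker G x) i = (if i < m then real (deg G (x ! i)) / d x else 0)"
proof -
  have len: "length x = m" using assms by (simp add: fs_states_def)
  have "(\<integral>\<^sup>+ i. ennreal (if i < m then real (deg G (x ! i)) / d x else 0) \<partial>count_space UNIV) =
      (\<Sum>i<m. ennreal (if i < m then real (deg G (x ! i)) / d x else 0))"
    by (rule nn_integral_count_space') auto
  also have "\<dots> = ennreal (\<Sum>i<m. real (deg G (x ! i)) / d x)"
    using d_pos[OF assms] by (simp add: sum_ennreal)
  also have "\<dots> = 1"
    using d_pos[OF assms] by (simp add: d_def flip: sum_divide_distrib)
  finally show ?thesis
    unfolding fs_walker_def len d_def[symmetric] using d_pos[OF assms]
    by (subst pmf_embed_pmf) auto
qed

text \<open>Walker \<open>i\<close> is chosen with probability \<open>deg / d x\<close> and then an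
  edge with probability \<open>1 / deg\<close>, so every pair of a walker and an outgoing edge has
  weight \<open>1 / d x\<close>. The map \<open>g\<close> covers both the next state and the sampled
  edge.\<close>

lemma pmf_map_fs_step:
  assumes "x \<in> S"
  shows "pmf (map_pmf g (fs_step G x)) z =
    (\<Sum>i<m. \<Sum>e\<in>E. if fst e = x ! i \<and> z = g (x[i := snd e], e) then 1 else 0) / d x"
proof -
  let ?c = "\<lambda>i. \<Sum>e\<in>E. if fst e = x ! i \<and> z = g (x[i := snd e], e) then 1 else 0 :: real"
  have inner: "pmf (pmf_of_set (out_arcs (with_proj G) (x ! i)) \<bind>
      (\<lambda>e. return_pmf (g (x[i := snd e], e)))) z = ?c i / real (deg G (x ! i))"
    if "i < m" for i
  proof -
    have ne: "{e \<in> E. fst e = x ! i} \<noteq> {}" and fin: "finite {e \<in> E. fst e = x ! i}"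
      using deg_pos[OF S_nth[OF assms that]] pair_finite_arcs by (auto simp: deg_eq_card card_gt_0_iff)
    have "(\<Sum>e\<in>{e \<in> E. fst e = x ! i}. pmf (return_pmf (g (x[i := snd e], e))) z) = ?c i"
      using pair_finite_arcs
      by (subst sum.inter_filter) (auto intro!: sum.cong split: split_indicator)
    then show ?thesis
      unfolding out_arcs_eq pmf_bind using ne fin
      by (subst integral_pmf_of_set) (auto simp: deg_eq_card)
  qed
  have "pmf (map_pmf g (fs_step G x)) z = (\<Sum>i<m. pmf (pmf_of_set (out_arcs (with_proj G) (x ! i)) \<bind>
      (\<lambda>e. return_pmf (g (x[i := snd e], e)))) z * pmf (fs_walker G x) i)"
    unfolding fs_step_def map_bind_pmf map_return_pmf
    by (subst pmf_bind, rule integral_measure_pmf_real)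
       (auto simp: set_pmf_iff pmf_fs_walker[OF assms] split: if_splits)
  also have "\<dots> = (\<Sum>i<m. ?c i / d x)"
    using deg_pos[OF S_nth[OF assms]]
    by (intro sum.cong refl) (auto simp: inner pmf_fs_walker[OF assms])
  finally show ?thesis by (simp add: sum_divide_distrib)
qed

lemma pmf_next_state: "x \<in> S \<Longrightarrow> pmf (map_pmf fst (fs_step G x)) y = w x y / d x"
  by (simp add: pmf_map_fs_step w_def)

lemma set_next_state:
  assumes "x \<in> S"
  shows "set_pmf (map_pmf fst (fs_step G x)) \<subseteq> S"
  using w_outside[OF assms] pmf_next_state[OF assms]
  by (metis div_0 pmf_eq_0_set_pmf subsetI)

text \<open>Read off from the fact that the transition probabilities \<open>w x y / d x\<close> sum
  to 1.\<close>

lemma sum_w: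
  assumes "x \<in> S"
  shows "(\<Sum>y\<in>S. w x y) = d x"
proof -
  have "(\<Sum>y\<in>S. w x y / d x) = 1"
    using sum_pmf_eq_1[OF finite_S set_next_state[OF assms]] by (simp add: pmf_next_state assms)
  then show ?thesis using d_pos[OF assms] by (simp add: field_simps flip: sum_divide_distrib)
qed

lemma pmf_next_edge:
  assumes "x \<in> S"
  shows "pmf (map_pmf snd (fs_step G x)) e =
    (if e \<in> E then (\<Sum>i<m. if x ! i = fst e then 1 else 0) / d x else 0)"
proof -
  have "(\<Sum>e'\<in>E. if fst e' = x ! i \<and> e = e' then 1 else 0 :: real) =
      (if e \<in> E then (if x ! i = fst e then 1 else 0) else 0)" for i
  proof -
    have "(\<Sum>e'\<in>E. if fst e' = x ! i \<and> e = e' then 1 else 0 :: real) =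
        (\<Sum>e'\<in>E. if e = e' then (if x ! i = fst e' then 1 else 0) else 0)"
      by (intro sum.cong) auto
    then show ?thesis using pair_finite_arcs by (simp add: sum.delta')
  qed
  then show ?thesis by (simp add: pmf_map_fs_step[OF assms])
qed

lemma sum_S_nth:
  fixes f :: "'a \<Rightarrow> real"
  shows "(\<Sum>x\<in>S. \<Sum>i<m. f (x ! i)) = real m * real (card V) ^ (m - 1) * (\<Sum>v\<in>V. f v)"
  unfolding fs_states_def
  by (subst sum.swap) (simp add: sum_lists_nth pair_finite_verts)

lemma D_eq: "D = real m * real (card V) ^ (m - 1) * real (vol G V)"
  unfolding D_def d_def by (simp add: sum_S_nth[of "\<lambda>v. real (deg G v)"] vol_def)

lemma vol_eq: "vol G V = card E"
proof -
  have "E = (\<Union>v\<in>V. {e \<in> E. fst e = v})"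
    by (auto dest: E_subset)
  then have "card E = card (\<Union>v\<in>V. {e \<in> E. fst e = v})" by simp
  also have "\<dots> = (\<Sum>v\<in>V. card {e \<in> E. fst e = v})"
    by (rule card_UN_disjoint) (auto simp: pair_finite_verts pair_finite_arcs)
  finally show ?thesis by (simp add: vol_def deg_eq_card)
qed

lemma E_nonempty: "E \<noteq> {}"
proof -
  obtain v where "v \<in> V" using V_nonempty by auto
  from deg_pos[OF this] show ?thesis
    by (auto simp: deg_eq_card)
qed

lemma card_E_pos: "card E > 0"
  using E_nonempty pair_finite_arcs by (simp add: card_gt_0_iff)

lemma D_pos: "D > 0"
  using m_pos card_E_pos V_nonempty pair_finite_verts
  by (simp add: D_eq vol_eq card_gt_0_iff)

text \<open>The factor \<open>d x\<close> cancels and leaves the number of walkers at the tail of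
  \<open>e\<close>. Summed over all states this is the same for every vertex.\<close>

lemma edge_uniform:
  assumes "e \<in> E"
  shows "(\<Sum>x\<in>S. d x / D * pmf (map_pmf snd (fs_step G x)) e) = 1 / real (card E)"
proof -
  have "(\<Sum>x\<in>S. d x / D * pmf (map_pmf snd (fs_step G x)) e) =
      (\<Sum>x\<in>S. (\<Sum>i<m. if x ! i = fst e then 1 else 0) / D)"
    using assms by (intro sum.cong refl) (auto simp: pmf_next_edge dest: d_pos)
  also have "\<dots> = real m * real (card V) ^ (m - 1) * (\<Sum>v\<in>V. if v = fst e then 1 else 0) / D"
    by (subst sum_divide_distrib[symmetric]) (simp only: sum_S_nth[of "\<lambda>v. if v = fst e then 1 else 0"])
  also have "(\<Sum>v\<in>V. if v = fst e then 1 else 0 :: real) = 1"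
    using E_subset(1)[of "fst e" "snd e"] assms pair_finite_verts by (simp add: sum.delta)
  finally show ?thesis
    using D_pos m_pos V_nonempty pair_finite_verts by (simp add: D_eq vol_eq)
qed

section \<open>Connectedness of the power\<close>

definition R :: "('a list \<times> 'a list) set" where
  "R = {(x, y). x \<in> S \<and> y \<in> S \<and> w x y > 0}"

lemma R_update:
  assumes "x \<in> S" "i < m" "(x ! i, v) \<in> E"
  shows "(x, x[i := v]) \<in> R"
proof -
  have "0 < (\<Sum>e\<in>E. if fst e = x ! i \<and> x[i := v] = x[i := snd e] then 1 else 0 :: real)"
    using pair_finite_arcs assms
    by (intro sum_pos2[where i = "(x ! i, v)"]) auto
  then have "0 < w x (x[i := v])"
    unfolding w_def using assms
    by (intro sum_pos2[where i = i]) (auto intro!: sum_nonneg)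
  then show ?thesis
    using assms E_subset(2)[OF assms(3)] by (simp add: R_def S_update)
qed

text \<open>Walker \<open>i\<close> follows a path of \<open>G\<close> from \<open>x ! i\<close> to
  \<open>v\<close> while the others stand still.\<close>

lemma R_rtrancl_update:
  assumes "x \<in> S" "i < m" "v \<in> V"
  shows "(x, x[i := v]) \<in> R\<^sup>*"
  using E_rtrancl[OF S_nth[OF assms(1,2)] assms(3)]
proof (induction rule: rtrancl_induct)
  case base
  then show ?case by simp
next
  case (step u v)
  have "length x = m" using assms(1) by (simp add: fs_states_def)
  then have "(x[i := u], (x[i := u])[i := v]) \<in> R"
    using step.hyps(2) assms E_subset(1)[OF step.hyps(2)] by (intro R_update) (auto simp: S_update)
  with step.IH show ?case by simp
qed

text \<open>The walkers are brought to their targets one after another; after \<open>k\<close> of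
  them the state is \<open>take k y @ drop k x\<close>.\<close>

lemma R_connected:
  assumes x: "x \<in> S" and y: "y \<in> S"
  shows "(x, y) \<in> R\<^sup>*"
proof -
  have len: "length x = m" "length y = m" using assms by (auto simp: fs_states_def)
  have "(x, take k y @ drop k x) \<in> R\<^sup>* \<and> take k y @ drop k x \<in> S" if "k \<le> m" for k
    using that
  proof (induction k)
    case 0
    then show ?case using x by simp
  next
    case (Suc k)
    let ?z = "take k y @ drop k x"
    have "?z[k := y ! k] = take (Suc k) y @ drop (Suc k) x"
      using Suc.prems len
      by (simp add: list_update_append take_Suc_conv_app_nth Cons_nth_drop_Suc[symmetric])
    moreover have "(?z, ?z[k := y ! k]) \<in> R\<^sup>*"
      using Suc by (intro R_rtrancl_update S_nth[OF y]) auto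
    moreover have "?z[k := y ! k] \<in> S"
      using Suc by (intro S_update S_nth[OF y]) auto
    ultimately show ?case using Suc by (metis Suc_leD rtrancl_trans)
  qed
  from this[of m] show ?thesis using len by simp
qed

section \<open>Stationary laws\<close>

text \<open>With \<open>q = c / d\<close>, symmetry of \<open>w\<close> turns the defect of
  stationarity into the Laplacian of \<open>q\<close>, so \<open>q\<close> becomes constant in the
  limit and the total mass fixes the constant as \<open>1 / D\<close>. The mass is 1 only eventually
  because the empirical distribution of zero steps is 0.\<close>

lemma asymptotically_stationary_tendsto:
  fixes c :: "nat \<Rightarrow> 'a list \<Rightarrow> real"
  assumes bdd: "\<And>n x. x \<in> S \<Longrightarrow> \<bar>c n x\<bar> \<le> 1"
    and total: "\<forall>\<^sub>F n in sequentially. (\<Sum>x\<in>S. c n x) = 1"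
    and stat: "\<And>y. y \<in> S \<Longrightarrow> (\<lambda>n. c n y - (\<Sum>x\<in>S. c n x * (w x y / d x))) \<longlonglongrightarrow> 0"
    and x: "x \<in> S"
  shows "(\<lambda>n. c n x) \<longlonglongrightarrow> d x / D"
proof -
  define q where "q n x = c n x / d x" for n x
  have c: "c n x = d x * q n x" if "x \<in> S" for n x
    using d_pos[OF that] by (simp add: q_def)
  have diff: "(\<lambda>n. q n a - q n b) \<longlonglongrightarrow> 0" if ab: "a \<in> S" "b \<in> S" for a b
  proof (rule asymptotically_harmonic_imp_constant[where w = w and S = S])
    show "(a, b) \<in> {(x, y). x \<in> S \<and> y \<in> S \<and> 0 < w x y}\<^sup>*"
      using R_connected[OF ab] by (simp add: R_def)
    show "Bseq (\<lambda>n. q n y)" if "y \<in> S" for y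
    proof (rule BseqI')
      show "norm (q n y) \<le> 1 / d y" for n
        using bdd[OF that, of n] d_pos[OF that] by (simp add: q_def divide_right_mono)
    qed
    show "(\<lambda>n. (\<Sum>z\<in>S. w y z) * q n y - (\<Sum>z\<in>S. w y z * q n z)) \<longlonglongrightarrow> 0" if y: "y \<in> S" for y
    proof -
      have "c n y - (\<Sum>x\<in>S. c n x * (w x y / d x)) =
          (\<Sum>z\<in>S. w y z) * q n y - (\<Sum>z\<in>S. w y z * q n z)" for n
        by (simp add: sum_w y c[OF y, symmetric]) (intro sum.cong refl, simp add: q_def w_sym[OF y])
      then show ?thesis using stat[OF y] by simp
    qed
  qed (auto simp: finite_S w_nonneg w_sym)
  \<comment> \<open>As \<open>d y * q n y\<close> sums to 1, this expression is
    \<open>D * q n x\<close>.\<close>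
  have "(\<lambda>n. 1 + (\<Sum>y\<in>S. d y * (q n x - q n y))) \<longlonglongrightarrow> 1 + (\<Sum>y\<in>S. d y * 0)"
    by (intro tendsto_add tendsto_sum tendsto_mult tendsto_const diff x)
  moreover have "\<forall>\<^sub>F n in sequentially. 1 + (\<Sum>y\<in>S. d y * (q n x - q n y)) = D * q n x"
    using total
  proof eventually_elim
    case (elim n)
    then have "(\<Sum>y\<in>S. d y * q n y) = 1" by (simp add: c)
    then show ?case
      by (simp add: D_def sum_distrib_right right_diff_distrib sum_subtractf)
  qed
  ultimately have "(\<lambda>n. D * q n x) \<longlonglongrightarrow> 1" by (simp add: tendsto_cong)
  then have "(\<lambda>n. d x / D * (D * q n x)) \<longlonglongrightarrow> d x / D * 1"
    by (intro tendsto_mult tendsto_const)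
  then show ?thesis using D_pos by (simp add: c[OF x])
qed

lemma pmf_bind_next_state:
  assumes "set_pmf p \<subseteq> S"
  shows "pmf (bind_pmf p (\<lambda>l. map_pmf fst (fs_step G l))) y = (\<Sum>x\<in>S. pmf p x * (w x y / d x))"
proof -
  have "pmf (bind_pmf p (\<lambda>l. map_pmf fst (fs_step G l))) y =
      (\<Sum>x\<in>S. pmf (map_pmf fst (fs_step G x)) y * pmf p x)"
    unfolding pmf_bind using assms finite_S by (intro integral_measure_pmf_real) auto
  then show ?thesis by (simp add: pmf_next_state mult.commute)
qed

text \<open>A stationary law, taken as a constant sequence, is asymptotically stationary, so it
  equals its own limit.\<close>

lemma stationary_unique:
  assumes "fs_stationary G m p"
  shows "pmf p x = (if x \<in> S then d x / D else 0)"
proof (cases "x \<in> S")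
  case True
  have p: "set_pmf p \<subseteq> S" "bind_pmf p (\<lambda>l. map_pmf fst (fs_step G l)) = p"
    using assms by (auto simp: fs_stationary_def)
  have "(\<lambda>n::nat. pmf p x) \<longlonglongrightarrow> d x / D"
  proof (rule asymptotically_stationary_tendsto[where c = "\<lambda>_. pmf p", OF _ _ _ True])
    show "(\<lambda>_. pmf p y - (\<Sum>x\<in>S. pmf p x * (w x y / d x))) \<longlonglongrightarrow> 0" for y
      using pmf_bind_next_state[OF p(1), of y] unfolding p(2) by (simp only: diff_self tendsto_const)
  qed (simp_all add: pmf_le_1 sum_pmf_eq_1[OF finite_S p(1)])
  then show ?thesis using True by (simp add: LIMSEQ_const_iff)
next
  case False
  then show ?thesis using assms by (auto simp: fs_stationary_def pmf_eq_0_set_pmf)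
qed

text \<open>Reversibility: the flow from \<open>x\<close> to \<open>y\<close> under
  \<open>d x / D\<close> is \<open>w x y / D\<close>, which is symmetric, so the inflow at
  \<open>y\<close> is \<open>d y / D\<close>.\<close>

lemma stationary_exists: "\<exists>p. fs_stationary G m p"
proof -
  define f where "f x = (if x \<in> S then d x / D else 0)" for x
  have nonneg: "f x \<ge> 0" for x
    using d_pos D_pos by (auto simp: f_def intro!: divide_nonneg_pos less_imp_le)
  have "(\<integral>\<^sup>+ x. ennreal (f x) \<partial>count_space UNIV) = (\<Sum>x\<in>S. ennreal (f x))"
    by (rule nn_integral_count_space') (auto simp: finite_S f_def)
  also have "\<dots> = ennreal (\<Sum>x\<in>S. d x / D)"
    using nonneg by (simp add: sum_ennreal) (simp add: f_def)
  also have "\<dots> = 1"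
    using D_pos by (simp add: D_def flip: sum_divide_distrib)
  finally have total: "(\<integral>\<^sup>+ x. ennreal (f x) \<partial>count_space UNIV) = 1" .
  define p where "p = embed_pmf f"
  have p: "pmf p x = f x" for x
    unfolding p_def by (rule pmf_embed_pmf[OF nonneg total])
  have S: "set_pmf p \<subseteq> S"
    by (auto simp: set_pmf_iff p f_def split: if_splits)
  have "pmf (bind_pmf p (\<lambda>l. map_pmf fst (fs_step G l))) y = pmf p y" for y
  proof -
    have "pmf (bind_pmf p (\<lambda>l. map_pmf fst (fs_step G l))) y = (\<Sum>x\<in>S. w x y / D)"
      unfolding pmf_bind_next_state[OF S]
      by (intro sum.cong refl) (auto simp: p f_def dest: d_pos)
    also have "\<dots> = f y"
    proof (cases "y \<in> S")
      case True
      then have "(\<Sum>x\<in>S. w x y / D) = (\<Sum>x\<in>S. w y x) / D"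
        by (simp add: w_sym[of y] sum_divide_distrib)
      then show ?thesis using True by (simp add: sum_w f_def)
    qed (simp add: w_outside f_def)
    finally show ?thesis by (simp add: p)
  qed
  then have "fs_stationary G m p"
    unfolding fs_stationary_def using S by (auto intro: pmf_eqI)
  then show ?thesis ..
qed

lemma stationary_next_edge:
  assumes "fs_stationary G m p"
  shows "bind_pmf p (\<lambda>l. map_pmf snd (fs_step G l)) = pmf_of_set E"
proof (rule pmf_eqI)
  fix e
  have "pmf (bind_pmf p (\<lambda>l. map_pmf snd (fs_step G l))) e =
      (\<Sum>x\<in>S. pmf (map_pmf snd (fs_step G x)) e * pmf p x)"
    unfolding pmf_bind using assms finite_S
    by (intro integral_measure_pmf_real) (auto simp: fs_stationary_def)
  also have "\<dots> = (\<Sum>x\<in>S. d x / D * pmf (map_pmf snd (fs_step G x)) e)"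
    by (simp add: stationary_unique[OF assms] mult.commute)
  also have "\<dots> = pmf (pmf_of_set E) e"
    using edge_uniform E_nonempty pair_finite_arcs
    by (cases "e \<in> E") (auto simp: pmf_next_edge)
  finally show "pmf (bind_pmf p (\<lambda>l. map_pmf snd (fs_step G l))) e = pmf (pmf_of_set E) e" .
qed

end

subsection \<open>The sampled process\<close>

text \<open>
  Histories are listed newest first; each state is paired with the edge sampled on entering it,
  which is \<open>undefined\<close> for the initial state.
\<close>

primrec fs_history :: "'a pair_pre_digraph \<Rightarrow> 'a list pmf \<Rightarrow> nat \<Rightarrow> ('a list \<times> ('a \<times> 'a)) list pmf" where
  "fs_history G p 0 = map_pmf (\<lambda>l. [(l, undefined)]) p"
| "fs_history G p (Suc n) =
    bind_pmf (fs_history G p n) (\<lambda>h. map_pmf (\<lambda>z. z # h) (fs_step G (fst (hd h))))"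

text \<open>Prepending is injective and the tail records the past, so only \<open>h\<close> can lead
  to \<open>z # h\<close>.\<close>

lemma pmf_fs_history_Cons:
  "pmf (fs_history G p (Suc n)) (z # h) = pmf (fs_history G p n) h * pmf (fs_step G (fst (hd h))) z"
proof -
  have inner: "pmf (map_pmf (\<lambda>z. z # h') (fs_step G (fst (hd h')))) (z # h) =
      (if h' = h then pmf (fs_step G (fst (hd h))) z else 0)" for h'
  proof (cases "h' = h")
    case True
    have "inj (\<lambda>z. z # h)" by (simp add: inj_def)
    from pmf_map_inj'[OF this] True show ?thesis by simp
  next
    case False
    then show ?thesis by (auto simp: pmf_eq_0_set_pmf)
  qed
  have "pmf (fs_history G p (Suc n)) (z # h) =
      (\<Sum>h'\<in>{h}. (if h' = h then pmf (fs_step G (fst (hd h))) z else 0) * pmf (fs_history G p n) h')"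
    unfolding fs_history.simps pmf_bind inner by (intro integral_measure_pmf_real) (auto split: if_splits)
  then show ?thesis by (simp add: mult.commute)
qed

text \<open>
  Vertices may live in an uncountable type, so the joint history \<open>H n\<close> need not be measurable
  into the discrete space; only the events \<open>H n = h\<close> are.
\<close>

locale steady_frontier_sampling = frontier_graph G m + frontier_sampling G m M L X
  for G :: "'a pair_pre_digraph" and m :: nat and M :: "'w measure"
    and L :: "nat \<Rightarrow> 'w \<Rightarrow> 'a list" and X :: "nat \<Rightarrow> 'w \<Rightarrow> 'a \<times> 'a" +
  fixes p :: "'a list pmf"
  assumes stationary: "fs_stationary G m p"
    and law_init: "distr M (count_space UNIV) (L 0) = measure_pmf p"
begin

primrec H :: "nat \<Rightarrow> 'w \<Rightarrow> ('a list \<times> ('a \<times> 'a)) list" where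
  "H 0 \<omega> = [(L 0 \<omega>, undefined)]"
| "H (Suc n) \<omega> = (L (Suc n) \<omega>, X n \<omega>) # H n \<omega>"

lemma hd_H: "fst (hd (H n \<omega>)) = L n \<omega>"
  by (cases n) auto

lemma H_eq_iff: "H n \<omega> = H n \<omega>' \<longleftrightarrow> (\<forall>k\<le>n. L k \<omega> = L k \<omega>') \<and> (\<forall>k<n. X k \<omega> = X k \<omega>')"
  by (induction n) (auto simp: le_Suc_eq less_Suc_eq)

lemma measurable_L [measurable]: "L n \<in> measurable M (count_space UNIV)"
  and measurable_X [measurable]: "X n \<in> measurable M (count_space UNIV)"
  by (fact random_variable_L random_variable_X)+

lemma measurable_fun_L: "(\<lambda>\<omega>. f (L n \<omega>)) \<in> borel_measurable M"
  and measurable_fun_X: "(\<lambda>\<omega>. g (X n \<omega>)) \<in> borel_measurable M"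
  by (rule measurable_compose[OF measurable_L] measurable_compose[OF measurable_X], simp)+

lemma H_event: "{\<omega> \<in> space M. H n \<omega> = h} \<in> events"
proof (induction n arbitrary: h)
  case 0
  have "{\<omega> \<in> space M. H 0 \<omega> = h} = L 0 -` {l. [(l, undefined)] = h} \<inter> space M" by auto
  also have "\<dots> \<in> events" by (rule measurable_sets[OF measurable_L]) simp
  finally show ?case .
next
  case (Suc n)
  show ?case
  proof (cases h)
    case (Cons z h')
    have "{\<omega> \<in> space M. H (Suc n) \<omega> = h} = (L (Suc n) -` {fst z} \<inter> space M) \<inter>
        (X n -` {snd z} \<inter> space M) \<inter> {\<omega> \<in> space M. H n \<omega> = h'}"
      unfolding Cons by (cases z) auto
    also have "\<dots> \<in> events"
      by (intro sets.Int Suc measurable_sets[OF measurable_L] measurable_sets[OF measurable_X]) auto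
    finally show ?thesis .
  qed simp
qed

text \<open>The assumption \<open>step\<close> is the recursion of
  \<open>pmf_fs_history_Cons\<close>, once a history is written as sequences of states and
  edges.\<close>

lemma prob_H: "prob {\<omega> \<in> space M. H n \<omega> = h} = pmf (fs_history G p n) h"
proof (induction n arbitrary: h)
  case 0
  have "prob {\<omega> \<in> space M. H 0 \<omega> = h} = measure (distr M (count_space UNIV) (L 0)) {l. [(l, undefined)] = h}"
    by (subst measure_distr) (auto simp: vimage_def Int_def conj_commute)
  also have "\<dots> = pmf (fs_history G p 0) h"
    by (simp add: law_init pmf_map vimage_def)
  finally show ?case .
next
  case (Suc n)
  show ?case
  proof (cases h)
    case Nil
    have "[] \<notin> set_pmf (fs_history G p (Suc n))" by auto
    then show ?thesis unfolding Nil by (simp add: pmf_eq_0_set_pmf del: fs_history.simps)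
  next
    case (Cons z h')
    have "prob {\<omega> \<in> space M. H (Suc n) \<omega> = z # h'} =
        prob {\<omega> \<in> space M. H n \<omega> = h'} * pmf (fs_step G (fst (hd h'))) z"
    \<comment> \<open>A list that no sample point realises, such as one of the wrong length, gives 0
      on both sides; otherwise a realising point supplies the sequences.\<close>
    proof (cases "\<exists>\<omega>. H n \<omega> = h'")
      case False
      then show ?thesis by simp
    next
      case True
      then obtain \<omega>' where \<omega>': "h' = H n \<omega>'" by auto
      \<comment> \<open>Only the indices \<open>Suc n\<close> of \<open>ls\<close> and
        \<open>n\<close> of \<open>es\<close> describe the new step; earlier ones copy
        \<open>\<omega>'\<close>.\<close>
      define ls where "ls k = (if k \<le> n then L k \<omega>' else fst z)" for k
      define es where "es k = (if k < n then X k \<omega>' else snd z)" for k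
      have 1: "{\<omega> \<in> space M. H (Suc n) \<omega> = z # h'} =
          {\<omega> \<in> space M. (\<forall>k\<le>Suc n. L k \<omega> = ls k) \<and> (\<forall>k\<le>n. X k \<omega> = es k)}"
        unfolding \<omega>' by (cases z) (auto simp: H_eq_iff ls_def es_def le_Suc_eq dest: le_neq_trans)
      have 2: "{\<omega> \<in> space M. H n \<omega> = h'} =
          {\<omega> \<in> space M. (\<forall>k\<le>n. L k \<omega> = ls k) \<and> (\<forall>k<n. X k \<omega> = es k)}"
        unfolding \<omega>' by (auto simp: H_eq_iff ls_def es_def)
      show ?thesis
        unfolding 1 2 step by (simp add: \<omega>' hd_H ls_def es_def)
    qed
    then show ?thesis unfolding Cons pmf_fs_history_Cons Suc .
  qed
qed

section \<open>Markov property and one-time laws\<close>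

text \<open>An adapted \<open>F\<close> is a function of \<open>H n\<close>, so the claim becomes an
  integral against \<open>fs_history\<close>, whose last step can be integrated out. Boundedness
  supplies integrability.\<close>

lemma markov_property:
  fixes F :: "'w \<Rightarrow> real" and \<phi> :: "'a list \<times> ('a \<times> 'a) \<Rightarrow> real"
  assumes F [measurable]: "F \<in> borel_measurable M"
    and F_bdd: "\<And>\<omega>. \<bar>F \<omega>\<bar> \<le> C"
    and adapted: "\<And>\<omega> \<omega>'. H n \<omega> = H n \<omega>' \<Longrightarrow> F \<omega> = F \<omega>'"
    and \<phi> [measurable]: "(\<lambda>\<omega>. \<phi> (L (Suc n) \<omega>, X n \<omega>)) \<in> borel_measurable M"
    and \<phi>_bdd: "\<And>z. \<bar>\<phi> z\<bar> \<le> C'"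
  shows "expectation (\<lambda>\<omega>. F \<omega> * \<phi> (L (Suc n) \<omega>, X n \<omega>)) =
    expectation (\<lambda>\<omega>. F \<omega> * measure_pmf.expectation (fs_step G (L n \<omega>)) \<phi>)"
proof -
  \<comment> \<open>By adaptedness any sample point with history \<open>h\<close> gives the same
    value. On unrealised lists the value is still one of \<open>F\<close>, so the bound
    \<open>C\<close> persists.\<close>
  define \<Phi> where "\<Phi> h = F (SOME \<omega>. H n \<omega> = h)" for h
  have \<Phi>: "\<Phi> (H n \<omega>) = F \<omega>" for \<omega>
    unfolding \<Phi>_def by (rule adapted) (rule someI[of _ \<omega>], rule refl)
  let ?k = "\<lambda>l. measure_pmf.expectation (fs_step G l) \<phi>"
  let ?\<Psi> = "\<lambda>h. \<Phi> (tl h) * \<phi> (hd h)"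
  have bdd: "\<bar>?\<Psi> h\<bar> \<le> C * C'" for h
    unfolding abs_mult using F_bdd \<phi>_bdd order_trans[OF abs_ge_zero F_bdd]
    by (intro mult_mono) (auto simp: \<Phi>_def)
  have "expectation (\<lambda>\<omega>. F \<omega> * \<phi> (L (Suc n) \<omega>, X n \<omega>)) = expectation (\<lambda>\<omega>. ?\<Psi> (H (Suc n) \<omega>))"
    by (simp add: \<Phi>)
  also have "\<dots> = measure_pmf.expectation (fs_history G p (Suc n)) ?\<Psi>"
    by (rule expectation_eq_pmf[OF H_event prob_H]) (simp add: \<Phi>)
  also have "\<dots> = measure_pmf.expectation (fs_history G p n) (\<lambda>h. \<Phi> h * ?k (fst (hd h)))"
    unfolding fs_history.simps by (subst integral_bind_pmf_bounded[OF bdd]) simp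
  also have "\<dots> = expectation (\<lambda>\<omega>. \<Phi> (H n \<omega>) * ?k (fst (hd (H n \<omega>))))"
    by (rule expectation_eq_pmf[OF H_event prob_H, symmetric])
       (auto simp: \<Phi> hd_H intro!: borel_measurable_times measurable_fun_L)
  finally show ?thesis by (simp add: \<Phi> hd_H)
qed

lemma expectation_step_bdd:
  fixes \<phi> :: "'a list \<times> ('a \<times> 'a) \<Rightarrow> real"
  assumes "\<And>z. \<bar>\<phi> z\<bar> \<le> C"
  shows "\<bar>measure_pmf.expectation (fs_step G l) \<phi>\<bar> \<le> C"
proof -
  have "\<bar>measure_pmf.expectation (fs_step G l) \<phi>\<bar> \<le> measure_pmf.expectation (fs_step G l) (\<lambda>z. \<bar>\<phi> z\<bar>)"
    by (rule integral_abs_bound)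
  also have "\<dots> \<le> measure_pmf.expectation (fs_step G l) (\<lambda>_. C)"
    using assms by (intro integral_mono measure_pmf.integrable_const_bound[where B = C])
      (simp_all add: order_trans[OF abs_ge_zero assms])
  finally show ?thesis by simp
qed

text \<open>The Markov property with \<open>F = 1\<close> moves one step back in time, and
  stationarity of \<open>p\<close> absorbs that step.\<close>

lemma law_L:
  fixes f :: "'a list \<Rightarrow> real"
  assumes "\<And>l. \<bar>f l\<bar> \<le> C"
  shows "expectation (\<lambda>\<omega>. f (L n \<omega>)) = measure_pmf.expectation p f"
  using assms
proof (induction n arbitrary: f)
  case 0
  have "measure_pmf.expectation p f = (\<integral>l. f l \<partial>distr M (count_space UNIV) (L 0))"
    by (simp add: law_init)
  also have "\<dots> = expectation (\<lambda>\<omega>. f (L 0 \<omega>))"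
    by (rule integral_distr) auto
  finally show ?case ..
next
  case (Suc n)
  have "expectation (\<lambda>\<omega>. f (L (Suc n) \<omega>)) =
      expectation (\<lambda>\<omega>. measure_pmf.expectation (fs_step G (L n \<omega>)) (\<lambda>z. f (fst z)))"
    using markov_property[of "\<lambda>_. 1" 1 n "\<lambda>z. f (fst z)" C] Suc.prems by (simp add: measurable_fun_L)
  also have "\<dots> = measure_pmf.expectation p (\<lambda>l. measure_pmf.expectation (fs_step G l) (\<lambda>z. f (fst z)))"
    by (rule Suc.IH) (rule expectation_step_bdd[OF Suc.prems])
  also have "\<dots> = measure_pmf.expectation (bind_pmf p (\<lambda>l. map_pmf fst (fs_step G l))) f"
    by (subst integral_bind_pmf_bounded[OF Suc.prems]) simp
  finally show ?case using stationary by (simp add: fs_stationary_def)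
qed

text \<open>Conditioning on \<open>L n\<close>, which has law \<open>p\<close>, yields the mixture
  of edge laws in \<open>stationary_next_edge\<close>.\<close>

lemma law_X: "distr M (count_space UNIV) (X n) = measure_pmf (pmf_of_set E)"
proof (rule distr_eq_measure_pmfI)
  fix e :: "'a \<times> 'a"
  let ?f = "indicator {e} :: 'a \<times> 'a \<Rightarrow> real"
  have f_bdd: "\<bar>?f x\<bar> \<le> 1" for x by simp
  have "prob {\<omega> \<in> space M. X n \<omega> = e} = expectation (\<lambda>\<omega>. ?f (X n \<omega>))"
    using prob_eq_expectation_indicator[OF measurable_X, of n "{e}"] by simp
  also have "\<dots> = expectation (\<lambda>\<omega>. measure_pmf.expectation (fs_step G (L n \<omega>)) (\<lambda>z. ?f (snd z)))"
    using markov_property[of "\<lambda>_. 1" 1 n "\<lambda>z. ?f (snd z)" 1] by (simp add: measurable_fun_X)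
  also have "\<dots> = measure_pmf.expectation p (\<lambda>l. measure_pmf.expectation (fs_step G l) (\<lambda>z. ?f (snd z)))"
    by (rule law_L[where C = 1]) (rule expectation_step_bdd, simp)
  also have "\<dots> = measure_pmf.expectation (bind_pmf p (\<lambda>l. map_pmf snd (fs_step G l))) ?f"
    by (simp only: integral_bind_pmf_bounded[OF f_bdd] integral_map_pmf)
  also have "\<dots> = pmf (pmf_of_set E) e"
    by (simp add: stationary_next_edge[OF stationary] measure_pmf_single)
  finally show "prob {\<omega> \<in> space M. X n \<omega> = e} = pmf (pmf_of_set E) e" .
qed (rule measurable_X)

section \<open>Stationarity of the edge sequence\<close>

text \<open>The probability that the walk started in \<open>l\<close> samples its j-th edge in
  \<open>A j\<close> for all j < N.\<close>

primrec edge_path_prob :: "nat \<Rightarrow> (nat \<Rightarrow> ('a \<times> 'a) set) \<Rightarrow> 'a list \<Rightarrow> real" where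
  "edge_path_prob 0 A l = 1"
| "edge_path_prob (Suc N) A l = measure_pmf.expectation (fs_step G l)
    (\<lambda>z. indicator (A 0) (snd z) * edge_path_prob N (\<lambda>j. A (Suc j)) (fst z))"

lemma edge_path_prob_bdd: "\<bar>edge_path_prob N A l\<bar> \<le> 1"
proof (induction N arbitrary: A l)
  case (Suc N)
  then show ?case
    by (simp only: edge_path_prob.simps, intro expectation_step_bdd)
       (auto simp: abs_mult split: split_indicator)
qed simp

text \<open>\<open>F\<close> is arbitrary so that the induction can absorb the first indicator into
  it: the product is adapted to the next history. The Markov property then integrates out the first
  step.\<close>

lemma expectation_edge_path:
  fixes F :: "'w \<Rightarrow> real"
  assumes "F \<in> borel_measurable M" "\<And>\<omega>. \<bar>F \<omega>\<bar> \<le> C"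
    and "\<And>\<omega> \<omega>'. H k \<omega> = H k \<omega>' \<Longrightarrow> F \<omega> = F \<omega>'"
  shows "expectation (\<lambda>\<omega>. F \<omega> * (\<Prod>j<N. indicator (A j) (X (k + j) \<omega>))) =
    expectation (\<lambda>\<omega>. F \<omega> * edge_path_prob N A (L k \<omega>))"
  using assms
proof (induction N arbitrary: k A F)
  case 0
  show ?case by simp
next
  case (Suc N)
  note [measurable] = Suc.prems(1)
  let ?F = "\<lambda>\<omega>. F \<omega> * indicator (A 0) (X k \<omega>)"
  have "expectation (\<lambda>\<omega>. F \<omega> * (\<Prod>j<Suc N. indicator (A j) (X (k + j) \<omega>))) =
      expectation (\<lambda>\<omega>. ?F \<omega> * (\<Prod>j<N. indicator (A (Suc j)) (X (Suc k + j) \<omega>)))"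
    by (simp only: prod.lessThan_Suc_shift) (simp add: mult.assoc)
  also have "\<dots> = expectation (\<lambda>\<omega>. ?F \<omega> * edge_path_prob N (\<lambda>j. A (Suc j)) (L (Suc k) \<omega>))"
  proof (rule Suc.IH)
    show "?F \<in> borel_measurable M"
      by (intro borel_measurable_times Suc.prems measurable_fun_X)
    show "\<bar>?F \<omega>\<bar> \<le> C" for \<omega>
      using Suc.prems(2)[of \<omega>] by (auto split: split_indicator)
    show "?F \<omega> = ?F \<omega>'" if "H (Suc k) \<omega> = H (Suc k) \<omega>'" for \<omega> \<omega>'
      using that Suc.prems(3)[of \<omega> \<omega>'] by simp
  qed
  also have "\<dots> = expectation (\<lambda>\<omega>. F \<omega> *
      (\<lambda>z. indicator (A 0) (snd z) * edge_path_prob N (\<lambda>j. A (Suc j)) (fst z)) (L (Suc k) \<omega>, X k \<omega>))"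
    by (simp add: mult.assoc)
  also have "\<dots> = expectation (\<lambda>\<omega>. F \<omega> * edge_path_prob (Suc N) A (L k \<omega>))"
    unfolding edge_path_prob.simps
  proof (rule markov_property[where C' = 1, OF Suc.prems])
    show "(\<lambda>\<omega>. indicator (A 0) (snd (L (Suc k) \<omega>, X k \<omega>)) *
        edge_path_prob N (\<lambda>j. A (Suc j)) (fst (L (Suc k) \<omega>, X k \<omega>))) \<in> borel_measurable M"
      unfolding fst_conv snd_conv by (intro borel_measurable_times measurable_fun_L measurable_fun_X)
    show "\<bar>indicator (A 0) (snd z) * edge_path_prob N (\<lambda>j. A (Suc j)) (fst z)\<bar> \<le> 1"
      for z :: "'a list \<times> ('a \<times> 'a)"
      using edge_path_prob_bdd by (auto split: split_indicator)
  qed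
  finally show ?case .
qed

text \<open>Cylinder sets determine the law. The probability of a cylinder shifted by
  \<open>k\<close> is the mean of \<open>edge_path_prob\<close> at \<open>L k\<close>, and all
  \<open>L k\<close> have law \<open>p\<close>.\<close>

lemma stationary_X: "stationary_sequence M (count_space UNIV) X"
  unfolding stationary_sequence_def
proof
  fix k
  have shift [measurable]: "(\<lambda>\<omega> n. X (n + k) \<omega>) \<in> measurable M (\<Pi>\<^sub>M n\<in>UNIV. count_space UNIV)" for k
    by (rule measurable_PiM_single') auto
  let ?P = "\<lambda>k. distr M (\<Pi>\<^sub>M n\<in>UNIV. count_space UNIV) (\<lambda>\<omega> n. X (n + k) \<omega>)"
  have "?P k = ?P 0"
  proof (rule measure_eqI_PiM_infinite)
    show "finite_measure (?P k)"
      by (intro prob_space.finite_measure prob_space_distr shift)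
    fix A :: "nat \<Rightarrow> ('a \<times> 'a) set" and J :: "nat set"
    assume J: "finite J"
    then obtain N where N: "J \<subseteq> {..<N}"
      by (metis finite_nat_iff_bounded)
    \<comment> \<open>Padding with \<open>UNIV\<close> turns the index set \<open>J\<close> into the
      initial segment below \<open>N\<close>.\<close>
    define A' where "A' j = (if j \<in> J then A j else UNIV)" for j
    let ?C = "prod_emb UNIV (\<lambda>_. count_space UNIV) J (Pi\<^sub>E J A)"
    have C: "?C = {x. \<forall>j<N. x j \<in> A' j}"
      using N by (auto simp: prod_emb_def A'_def PiE_iff space_PiM subset_iff)
    have C_sets: "?C \<in> sets (\<Pi>\<^sub>M n\<in>UNIV. count_space UNIV)"
      using J by (intro sets_PiM_I) auto
    have "measure (?P k) ?C = measure_pmf.expectation p (edge_path_prob N A')" for k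
    proof -
      have "measure (?P k) ?C = prob ((\<lambda>\<omega> n. X (n + k) \<omega>) -` ?C \<inter> space M)"
        by (rule measure_distr[OF shift C_sets])
      also have "\<dots> = expectation (indicator ((\<lambda>\<omega> n. X (n + k) \<omega>) -` ?C \<inter> space M))"
        by simp
      also have "\<dots> = expectation (\<lambda>\<omega>. 1 * (\<Prod>j<N. indicator (A' j) (X (k + j) \<omega>)))"
        unfolding C
        by (intro Bochner_Integration.integral_cong)
           (auto simp: indicator_def add.commute prod_zero_iff)
      also have "\<dots> = expectation (\<lambda>\<omega>. 1 * edge_path_prob N A' (L k \<omega>))"
        by (rule expectation_edge_path[where C = 1]) auto
      also have "\<dots> = measure_pmf.expectation p (edge_path_prob N A')"
        unfolding mult_1 by (rule law_L[OF edge_path_prob_bdd])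
      finally show ?thesis .
    qed
    then have "measure (?P k) ?C = measure (?P 0) ?C"
      by metis
    then show "emeasure (?P k) ?C = emeasure (?P 0) ?C"
      by (metis finite_measure.emeasure_eq_measure prob_space.finite_measure prob_space_distr shift)
  qed simp_all
  then show "?P k = distr M (\<Pi>\<^sub>M n\<in>UNIV. count_space UNIV) (\<lambda>\<omega> n. X n \<omega>)"
    by simp
qed

section \<open>Strong law of large numbers\<close>

text \<open>The centred terms are martingale differences: an earlier one is determined by the
  history, and given that history the later one has mean 0.\<close>

lemma slln_step:
  fixes \<phi> :: "'a list \<times> ('a \<times> 'a) \<Rightarrow> real"
  assumes \<phi>: "\<And>n. (\<lambda>\<omega>. \<phi> (L (Suc n) \<omega>, X n \<omega>)) \<in> borel_measurable M"
    and \<phi>_bdd: "\<And>z. \<bar>\<phi> z\<bar> \<le> C"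
  shows "AE \<omega> in M. (\<lambda>B. (\<Sum>n<B. \<phi> (L (Suc n) \<omega>, X n \<omega>) -
    measure_pmf.expectation (fs_step G (L n \<omega>)) \<phi>) / real B) \<longlonglongrightarrow> 0"
proof (rule slln_bounded_orthogonal[where C = "2 * C"])
  let ?k = "\<lambda>l. measure_pmf.expectation (fs_step G l) \<phi>"
  let ?D = "\<lambda>n \<omega>. \<phi> (L (Suc n) \<omega>, X n \<omega>) - ?k (L n \<omega>)"
  have k_bdd: "\<bar>?k l\<bar> \<le> C" for l
    by (rule expectation_step_bdd[OF \<phi>_bdd])
  show meas: "?D n \<in> borel_measurable M" for n
    by (intro borel_measurable_diff \<phi> measurable_fun_L)
  show bdd: "\<bar>?D n \<omega>\<bar> \<le> 2 * C" for n \<omega>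
    using \<phi>_bdd[of "(L (Suc n) \<omega>, X n \<omega>)"] k_bdd[of "L n \<omega>"] by linarith
  fix i j :: nat assume "i < j"
  have C: "C \<ge> 0" using order_trans[OF abs_ge_zero \<phi>_bdd] by blast
  have int1: "integrable M (\<lambda>\<omega>. ?D i \<omega> * \<phi> (L (Suc j) \<omega>, X j \<omega>))"
    by (rule integrable_const_bound[where B = "2 * C * C", OF AE_I2])
       (use C in \<open>auto simp only: real_norm_def abs_mult
         intro!: mult_mono bdd \<phi>_bdd borel_measurable_times meas \<phi>\<close>)
  have int2: "integrable M (\<lambda>\<omega>. ?D i \<omega> * ?k (L j \<omega>))"
    by (rule integrable_const_bound[where B = "2 * C * C", OF AE_I2])
       (use C in \<open>auto simp only: real_norm_def abs_mult
         intro!: mult_mono bdd k_bdd borel_measurable_times meas measurable_fun_L\<close>)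
  have "expectation (\<lambda>\<omega>. ?D i \<omega> * ?D j \<omega>) =
      expectation (\<lambda>\<omega>. ?D i \<omega> * \<phi> (L (Suc j) \<omega>, X j \<omega>)) - expectation (\<lambda>\<omega>. ?D i \<omega> * ?k (L j \<omega>))"
    unfolding right_diff_distrib[of "?D i _"]
    by (rule Bochner_Integration.integral_diff[OF int1 int2])
  also have "\<dots> = 0"
    \<comment> \<open>The term \<open>?D i\<close> involves time at most \<open>Suc i\<close>, which
      is at most \<open>j\<close>, so it is determined by \<open>H j\<close>.\<close>
    using markov_property[OF meas[of i] bdd _ \<phi> \<phi>_bdd, of j] \<open>i < j\<close>
    by (simp add: H_eq_iff)
  finally show "expectation (\<lambda>\<omega>. ?D i \<omega> * ?D j \<omega>) = 0" .
qed

lemma AE_L_in_S: "AE \<omega> in M. \<forall>n. L n \<omega> \<in> S"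
  unfolding AE_all_countable
proof
  fix n
  have "prob {\<omega> \<in> space M. L n \<omega> \<in> S} = expectation (\<lambda>\<omega>. indicator S (L n \<omega>))"
    by (rule prob_eq_expectation_indicator[OF measurable_L])
  also have "\<dots> = measure_pmf.expectation p (indicator S)"
    by (rule law_L[where C = 1]) (auto split: split_indicator)
  also have "\<dots> = 1"
    using stationary by (simp add: fs_stationary_def measure_pmf.prob_eq_1 AE_measure_pmf_iff subset_iff)
  finally have "prob {\<omega> \<in> space M. L n \<omega> \<in> S} = 1" .
  moreover have "{\<omega> \<in> space M. L n \<omega> \<in> S} = L n -` S \<inter> space M" by auto
  then have "{\<omega> \<in> space M. L n \<omega> \<in> S} \<in> events"
    using measurable_sets[OF measurable_L, of S n] by simp
  ultimately show "AE \<omega> in M. L n \<omega> \<in> S"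
    by (simp add: prob_Collect_eq_1)
qed

text \<open>The visits counted one step later differ by a boundary term, and
  \<open>slln_step\<close> replaces them by transition probabilities. Hence the empirical
  distribution is asymptotically stationary.\<close>

lemma AE_state_frequency:
  "AE \<omega> in M. \<forall>x\<in>S. (\<lambda>B. (\<Sum>n<B. if L n \<omega> = x then 1 else 0) / real B) \<longlonglongrightarrow> d x / D"
proof -
  have "AE \<omega> in M. \<forall>y\<in>S. (\<lambda>B. (\<Sum>n<B. (if L (Suc n) \<omega> = y then 1 else 0) -
      pmf (map_pmf fst (fs_step G (L n \<omega>))) y) / real B) \<longlonglongrightarrow> 0"
    using slln_step[of "\<lambda>z. if fst z = _ then 1 else 0" 1] finite_S
    by (intro AE_finite_allI) (simp_all add: expectation_indicator_map measurable_fun_L)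
  with AE_L_in_S show ?thesis
  proof eventually_elim
    case (elim \<omega>)
    note LS = elim(1)[rule_format]
    define c where "c B x = (\<Sum>n<B. if L n \<omega> = x then 1 else 0) / real B" for B x
    show ?case unfolding c_def[symmetric]
    proof (intro ballI asymptotically_stationary_tendsto)
      show "\<bar>c B x\<bar> \<le> 1" for B x
      proof -
        have "(\<Sum>n<B. if L n \<omega> = x then 1 else 0 :: real) \<le> (\<Sum>n<B. 1)"
          by (intro sum_mono) auto
        moreover have "(\<Sum>n<B. if L n \<omega> = x then 1 else 0 :: real) \<ge> 0"
          by (intro sum_nonneg) auto
        ultimately show ?thesis unfolding c_def by (auto simp: divide_le_eq_1)
      qed
      have avg: "(\<Sum>x\<in>S. c B x * f x) = (\<Sum>n<B. f (L n \<omega>)) / real B" for B and f :: "_ \<Rightarrow> real"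
        unfolding c_def by (rule sum_frequencies[OF finite_S LS])
      show "\<forall>\<^sub>F B in sequentially. (\<Sum>x\<in>S. c B x) = 1"
        using eventually_gt_at_top[of 0]
      proof eventually_elim
        case (elim B)
        then show ?case using avg[of B "\<lambda>_. 1"] by simp
      qed
      show "(\<lambda>B. c B y - (\<Sum>x\<in>S. c B x * (w x y / d x))) \<longlonglongrightarrow> 0" if y: "y \<in> S" for y
      proof -
        let ?I = "\<lambda>n. if L n \<omega> = y then 1 else 0 :: real"
        \<comment> \<open>Shifting the index telescopes; only the indicators at times
          \<open>0\<close> and \<open>B\<close> remain, and they vanish after division by
          \<open>B\<close>.\<close>
        have "c B y - (\<Sum>x\<in>S. c B x * (w x y / d x)) =
            (\<Sum>n<B. ?I (Suc n) - pmf (map_pmf fst (fs_step G (L n \<omega>))) y) / real B - (?I B - ?I 0) / real B" for B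
        proof -
          have "(\<Sum>n<B. ?I (Suc n)) = (\<Sum>n<B. ?I n) + (?I B - ?I 0)"
            using sum_lessThan_telescope[of ?I B] by (simp add: sum_subtractf)
          then show ?thesis
            unfolding avg[of _ "\<lambda>x. w x y / d x"] unfolding c_def using LS
            by (simp add: pmf_next_state sum_subtractf diff_divide_distrib add_divide_distrib)
        qed
        moreover have "(\<lambda>B. (?I B - ?I 0) / real B) \<longlonglongrightarrow> 0"
          by (rule Lim_null_comparison[OF _ lim_const_over_n[of 1]])
             (auto intro!: always_eventually divide_right_mono)
        ultimately show ?thesis
          using tendsto_diff[OF elim(2)[rule_format, OF y]] by fastforce
      qed
    qed
  qed
qed

text \<open>By \<open>slln_step\<close> the edge frequency follows the average conditional
  probability, an integral against the empirical state distribution. Its limit is the uniform value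
  from \<open>edge_uniform\<close>.\<close>

lemma AE_edge_frequency:
  "AE \<omega> in M. \<forall>e\<in>E. (\<lambda>B. (\<Sum>n<B. if X n \<omega> = e then 1 else 0) / real B) \<longlonglongrightarrow> 1 / real (card E)"
proof -
  have "AE \<omega> in M. \<forall>e\<in>E. (\<lambda>B. (\<Sum>n<B. (if X n \<omega> = e then 1 else 0) -
      pmf (map_pmf snd (fs_step G (L n \<omega>))) e) / real B) \<longlonglongrightarrow> 0"
    using slln_step[of "\<lambda>z. if snd z = _ then 1 else 0" 1] pair_finite_arcs
    by (intro AE_finite_allI) (simp_all add: expectation_indicator_map measurable_fun_X)
  with AE_L_in_S AE_state_frequency show ?thesis
  proof eventually_elim
    case (elim \<omega>)
    show ?case
    proof
      fix e assume e: "e \<in> E"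
      let ?k = "\<lambda>l. pmf (map_pmf snd (fs_step G l)) e"
      have "(\<lambda>B. \<Sum>x\<in>S. (\<Sum>n<B. if L n \<omega> = x then 1 else 0) / real B * ?k x) \<longlonglongrightarrow> (\<Sum>x\<in>S. d x / D * ?k x)"
        using elim(2) by (intro tendsto_sum tendsto_mult tendsto_const) auto
      also have "(\<Sum>x\<in>S. d x / D * ?k x) = 1 / real (card E)"
        by (rule edge_uniform[OF e])
      finally have "(\<lambda>B. (\<Sum>n<B. (if X n \<omega> = e then 1 else 0) - ?k (L n \<omega>)) / real B +
          (\<Sum>x\<in>S. (\<Sum>n<B. if L n \<omega> = x then 1 else 0) / real B * ?k x)) \<longlonglongrightarrow> 0 + 1 / real (card E)"
        using elim(3) e by (intro tendsto_add) auto
      moreover have "(\<Sum>n<B. (if X n \<omega> = e then 1 else 0) - ?k (L n \<omega>)) / real B +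
          (\<Sum>x\<in>S. (\<Sum>n<B. if L n \<omega> = x then 1 else 0) / real B * ?k x) =
          (\<Sum>n<B. if X n \<omega> = e then 1 else 0) / real B" for B
      proof -
        have "(\<Sum>x\<in>S. (\<Sum>n<B. if L n \<omega> = x then 1 else 0) / real B * ?k x) = (\<Sum>n<B. ?k (L n \<omega>)) / real B"
          using elim(1) by (intro sum_frequencies finite_S) simp
        then show ?thesis by (simp add: sum_subtractf diff_divide_distrib)
      qed
      ultimately show "(\<lambda>B. (\<Sum>n<B. if X n \<omega> = e then 1 else 0) / real B) \<longlonglongrightarrow> 1 / real (card E)"
        by simp
    qed
  qed
qed

text \<open>All edges of \<open>Estar\<close> have the same positive limiting frequency, so hit
  averages converge to the plain mean.\<close>

lemma slln_X:
  fixes f :: "'a \<times> 'a \<Rightarrow> real"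
  assumes "Estar \<noteq> {}" "Estar \<subseteq> E"
  shows "AE \<omega> in M.
    (\<lambda>B. 1 / real (num_hits (\<lambda>n. X n \<omega>) Estar B) *
         (\<Sum>i<num_hits (\<lambda>n. X n \<omega>) Estar B. f (nth_hit (\<lambda>n. X n \<omega>) Estar i)))
    \<longlonglongrightarrow> 1 / real (card Estar) * (\<Sum>e\<in>Estar. f e)"
  using AE_edge_frequency
proof eventually_elim
  case (elim \<omega>)
  show ?case
  proof (rule equal_frequencies_imp_hit_average)
    show "finite Estar" using assms(2) pair_finite_arcs by (rule finite_subset)
    show "0 < 1 / real (card E)" using card_E_pos by simp
    show "(\<lambda>B. (\<Sum>n<B. if X n \<omega> = e then 1 else 0) / real B) \<longlonglongrightarrow> 1 / real (card E)"
      if "e \<in> Estar" for e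
      using elim assms(2) that by auto
  qed fact
qed

end

theorem theorem2:
  fixes G :: "'a pair_pre_digraph" and m :: nat
  assumes "pair_pseudo_graph G"
    and "Digraph_Component.connected (with_proj G)"
    and "\<not> bipartite G"
    and "m \<ge> 1"
  shows
    "(\<forall>(M :: 'w measure) L X. fs_steady_state G m M L X \<longrightarrow>
        (\<forall>n. distr M (count_space UNIV) (X n) = measure_pmf (pmf_of_set (parcs G))) \<and>
        stationary_sequence M (count_space UNIV) X) \<and>
     ((\<exists>!p. fs_stationary G m p) \<and>
      (\<forall>p. fs_stationary G m p \<longrightarrow>
        (\<forall>l \<in> fs_states G m.
          pmf p l = (\<Sum>i<m. real (deg G (l ! i))) /
            (real m * real (card (pverts G)) ^ (m - 1) * real (vol G (pverts G)))))) \<and>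
     (\<forall>(M :: 'w measure) L X. fs_steady_state G m M L X \<longrightarrow>
        (\<forall>Estar (f :: 'a \<times> 'a \<Rightarrow> real).
          Estar \<noteq> {} \<longrightarrow> Estar \<subseteq> parcs G \<longrightarrow> (\<lambda>e. \<bar>f e\<bar>) summable_on Estar \<longrightarrow>
          (AE \<omega> in M.
            (\<lambda>B. 1 / real (num_hits (\<lambda>n. X n \<omega>) Estar B) *
                 (\<Sum>i<num_hits (\<lambda>n. X n \<omega>) Estar B. f (nth_hit (\<lambda>n. X n \<omega>) Estar i)))
            \<longlonglongrightarrow> 1 / real (card Estar) * (\<Sum>e\<in>Estar. f e))))"
proof -
  interpret pair_pseudo_graph G by fact
  interpret frontier_graph G m
    using assms by unfold_locales auto
  \<comment> \<open>Fixes the stationary initial law as a locale parameter, so that the results on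
    the steady process apply.\<close>
  have steady: "\<exists>p. steady_frontier_sampling G m M L X p" if "fs_steady_state G m M L X"
    for M :: "'w measure" and L X
  proof -
    from that obtain p where FS: "frontier_sampling G m M L X"
      and p: "fs_stationary G m p" "distr M (count_space UNIV) (L 0) = measure_pmf p"
      unfolding fs_steady_state_def by blast
    interpret frontier_sampling G m M L X by (rule FS)
    have "steady_frontier_sampling G m M L X p"
      using p by unfold_locales
    then show ?thesis ..
  qed
  show ?thesis
  proof (intro conjI allI impI ballI)
    fix M :: "'w measure" and L X n
    assume "fs_steady_state G m M L X"
    from steady[OF this] obtain p where "steady_frontier_sampling G m M L X p" ..
    then interpret steady_frontier_sampling G m M L X p .
    show "distr M (count_space UNIV) (X n) = measure_pmf (pmf_of_set E)"
      by (rule law_X)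
    show "stationary_sequence M (count_space UNIV) X"
      by (rule stationary_X)
  next
    show "\<exists>!p. fs_stationary G m p"
      using stationary_exists stationary_unique by (auto intro!: pmf_eqI)
    show "pmf p l = (\<Sum>i<m. real (deg G (l ! i))) /
        (real m * real (card V) ^ (m - 1) * real (vol G V))"
      if "fs_stationary G m p" "l \<in> S" for p l
      using stationary_unique[OF that(1), of l] that(2) by (simp add: d_def D_eq)
  next
    fix M :: "'w measure" and L X Estar and f :: "'a \<times> 'a \<Rightarrow> real"
    assume "fs_steady_state G m M L X" and Estar: "Estar \<noteq> {}" "Estar \<subseteq> E"
    from steady[OF this(1)] obtain p where "steady_frontier_sampling G m M L X p" ..
    then interpret steady_frontier_sampling G m M L X p .
    show "AE \<omega> in M.
        (\<lambda>B. 1 / real (num_hits (\<lambda>n. X n \<omega>) Estar B) *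
             (\<Sum>i<num_hits (\<lambda>n. X n \<omega>) Estar B. f (nth_hit (\<lambda>n. X n \<omega>) Estar i)))
        \<longlonglongrightarrow> 1 / real (card Estar) * (\<Sum>e\<in>Estar. f e)"
      by (rule slln_X[OF Estar])
  qed
qed

end
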